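(* Let $\Delta$ be a locally finite thick semi-regular right-angled building. Then the group $\mathrm{Aut}(\Delta)$ is Noetherian.
   Context: A Coxeter system $(W,S)$ ($S$ finite) is right-angled if all entries of its Coxeter matrix are $1,2$ or $\infty$. A chamber system with index set $S$ is an edge-colored graph with color set $S$ such that for each $s\in S$ every $s$-panel (connected component of the graph formed by the edges of color $s$) is a complete graph with at least two vertices; vertices are called chambers. A right-angled building of type $(W,S)$ is a chamber system $\Delta$ with index set $S$ together with a Weyl distance $\delta\colon \mathrm{Ch}(\Delta)\times\mathrm{Ch}(\Delta)\to W$, where $(W,S)$ is right-angled, such that for every reduced word $w$ representing $\overline{w}\in W$: $\delta(c_1,c_2)=\overline{w}$ iff there is a gallery (path) of type $w$ (sequence of colors) from $c_1$ to $c_2$. It is thick if every panel has at least three chambers, locally finite if every panel is finite, and semi-regular if for each $s$ all $s$-panels have the same cardinality. $\mathrm{Aut}(\Delta)$ is the group of type-preserving (color-preserving) automorphisms, with the permutation topology coming from its action on the set of chambers (pointwise stabilizers of finite sets of chambers form a basis of neighbourhoods of the identity). A topological group is called Noetherian if it satisfies the ascending chain condition on open subgroups. *)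

theory Defs
  imports
    "HOL-Analysis.Abstract_Topology"
    "HOL-Analysis.Product_Topology"
    "HOL-Algebra.Bij"
    "HOL-Algebra.Multiplicative_Group"
    "HOL-Library.Extended_Nat"
    "HOL-Library.Equipollence"
begin

section \<open>Right-angled Coxeter systems\<close>

text \<open>The generators are elements of the group. A word is a list of generators.\<close>

definition word_eval :: "('w, 'm) monoid_scheme \<Rightarrow> 'w list \<Rightarrow> 'w" where
  "word_eval W w = foldr (\<otimes>\<^bsub>W\<^esub>) w \<one>\<^bsub>W\<^esub>"

definition reduced_word :: "('w, 'm) monoid_scheme \<Rightarrow> 'w set \<Rightarrow> 'w list \<Rightarrow> bool" where
  "reduced_word W S w \<longleftrightarrow>
     w \<in> lists S \<and> (\<forall>v \<in> lists S. word_eval W v = word_eval W w \<longrightarrow> length w \<le> length v)"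

text \<open>The constant \<^const>\<open>group.ord\<close> takes the value 0 on elements of infinite order.\<close>

definition coxeter_matrix :: "('w, 'm) monoid_scheme \<Rightarrow> 'w \<Rightarrow> 'w \<Rightarrow> enat" where
  "coxeter_matrix W s t =
     (let n = group.ord W (s \<otimes>\<^bsub>W\<^esub> t) in if n = 0 then \<infinity> else enat n)"

text \<open>
  The congruence on words over \<open>S\<close> generated by the Coxeter relations
  \<open>(s t)\<^sup>m = 1\<close>, where \<open>m\<close> is a finite entry \<open>m s t\<close> of the matrix. When the diagonal entries
  are 1, the relations include \<open>s s = 1\<close>, so formal inverses of generators are not needed and
  the quotient of the free monoid by this congruence is the group presented by these relations.
\<close>

inductive coxeter_equiv :: "'w set \<Rightarrow> ('w \<Rightarrow> 'w \<Rightarrow> enat) \<Rightarrow> 'w list \<Rightarrow> 'w list \<Rightarrow> bool"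
  for S :: "'w set" and m :: "'w \<Rightarrow> 'w \<Rightarrow> enat"
  where
    relator: "\<lbrakk>u \<in> lists S; v \<in> lists S; s \<in> S; t \<in> S; m s t = enat n\<rbrakk>
      \<Longrightarrow> coxeter_equiv S m (u @ concat (replicate n [s, t]) @ v) (u @ v)"
  | refl: "u \<in> lists S \<Longrightarrow> coxeter_equiv S m u u"
  | sym: "coxeter_equiv S m u v \<Longrightarrow> coxeter_equiv S m v u"
  | trans: "\<lbrakk>coxeter_equiv S m u v; coxeter_equiv S m v w\<rbrakk> \<Longrightarrow> coxeter_equiv S m u w"

text \<open>
  The last assumption says that \<open>W\<close> is presented by \<open>S\<close> subject to the Coxeter relations
  (the implication from right to left always holds).
\<close>

locale coxeter_system = group W for W (structure) +
  fixes S :: "'a set"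
  assumes finite_generators: "finite S"
    and generators_closed: "S \<subseteq> carrier W"
    and generators_order: "s \<in> S \<Longrightarrow> ord s = 2"
    and generated: "generate W S = carrier W"
    and presentation: "\<lbrakk>u \<in> lists S; v \<in> lists S\<rbrakk> \<Longrightarrow>
      word_eval W u = word_eval W v \<longleftrightarrow> coxeter_equiv S (coxeter_matrix W) u v"

locale right_angled_coxeter_system = coxeter_system +
  assumes right_angled: "\<lbrakk>s \<in> S; t \<in> S\<rbrakk> \<Longrightarrow> coxeter_matrix W s t \<in> {1, 2, \<infinity>}"

section \<open>Chamber systems\<close>

record ('c, 's) edge_colored_graph =
  chambers :: "'c set"
  edges :: "'c set set"
  color :: "'c set \<Rightarrow> 's"

definition adjacent :: "('c, 's) edge_colored_graph \<Rightarrow> 's \<Rightarrow> 'c \<Rightarrow> 'c \<Rightarrow> bool" where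
  "adjacent \<Delta> s x y \<longleftrightarrow> {x, y} \<in> edges \<Delta> \<and> color \<Delta> {x, y} = s"

definition panels :: "('c, 's) edge_colored_graph \<Rightarrow> 's \<Rightarrow> 'c set set" where
  "panels \<Delta> s = {{d. (adjacent \<Delta> s)\<^sup>*\<^sup>* c d} | c. c \<in> chambers \<Delta>}"

locale chamber_system =
  fixes I :: "'s set" and \<Delta> :: "('c, 's) edge_colored_graph"
  assumes edge_endpoints: "e \<in> edges \<Delta> \<Longrightarrow> e \<subseteq> chambers \<Delta> \<and> card e = 2"
    and edge_color: "e \<in> edges \<Delta> \<Longrightarrow> color \<Delta> e \<in> I"
    and panel_complete: "\<lbrakk>s \<in> I; P \<in> panels \<Delta> s; x \<in> P; y \<in> P; x \<noteq> y\<rbrakk> \<Longrightarrow> adjacent \<Delta> s x y"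
    and panel_two: "\<lbrakk>s \<in> I; P \<in> panels \<Delta> s\<rbrakk> \<Longrightarrow> \<exists>x \<in> P. \<exists>y \<in> P. x \<noteq> y"

text \<open>\<open>gallery \<Delta> w c d\<close>: there is a path from \<open>c\<close> to \<open>d\<close> whose sequence of colors is \<open>w\<close>.\<close>

fun gallery :: "('c, 's) edge_colored_graph \<Rightarrow> 's list \<Rightarrow> 'c \<Rightarrow> 'c \<Rightarrow> bool" where
  "gallery \<Delta> [] c d \<longleftrightarrow> c = d"
| "gallery \<Delta> (s # w) c d \<longleftrightarrow> (\<exists>c'. adjacent \<Delta> s c c' \<and> gallery \<Delta> w c' d)"

section \<open>Right-angled buildings\<close>

locale right_angled_building = right_angled_coxeter_system W S + chamber_system S \<Delta>
  for W :: "('w, 'm) monoid_scheme" (structure) and S :: "'w set"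
    and \<Delta> :: "('c, 'w) edge_colored_graph" +
  fixes \<delta> :: "'c \<Rightarrow> 'c \<Rightarrow> 'w"
  assumes weyl_distance_closed:
      "\<lbrakk>c \<in> chambers \<Delta>; d \<in> chambers \<Delta>\<rbrakk> \<Longrightarrow> \<delta> c d \<in> carrier W"
    and weyl_distance_gallery:
      "\<lbrakk>c \<in> chambers \<Delta>; d \<in> chambers \<Delta>; reduced_word W S w\<rbrakk> \<Longrightarrow>
         \<delta> c d = word_eval W w \<longleftrightarrow> gallery \<Delta> w c d"

definition thick :: "'s set \<Rightarrow> ('c, 's) edge_colored_graph \<Rightarrow> bool" where
  "thick I \<Delta> \<longleftrightarrow> (\<forall>s \<in> I. \<forall>P \<in> panels \<Delta> s. infinite P \<or> card P \<ge> 3)"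

definition locally_finite :: "'s set \<Rightarrow> ('c, 's) edge_colored_graph \<Rightarrow> bool" where
  "locally_finite I \<Delta> \<longleftrightarrow> (\<forall>s \<in> I. \<forall>P \<in> panels \<Delta> s. finite P)"

definition semi_regular :: "'s set \<Rightarrow> ('c, 's) edge_colored_graph \<Rightarrow> bool" where
  "semi_regular I \<Delta> \<longleftrightarrow> (\<forall>s \<in> I. \<forall>P \<in> panels \<Delta> s. \<forall>Q \<in> panels \<Delta> s. P \<approx> Q)"

section \<open>The automorphism group and its permutation topology\<close>

definition Aut :: "('c, 's) edge_colored_graph \<Rightarrow> ('c \<Rightarrow> 'c) monoid" where
  "Aut \<Delta> = BijGroup (chambers \<Delta>)
     \<lparr>carrier := {g \<in> Bij (chambers \<Delta>). \<forall>s. \<forall>x \<in> chambers \<Delta>. \<forall>y \<in> chambers \<Delta>.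
        adjacent \<Delta> s (g x) (g y) \<longleftrightarrow> adjacent \<Delta> s x y}\<rparr>"

definition pointwise_stabilizer :: "('c \<Rightarrow> 'c, 'm) monoid_scheme \<Rightarrow> 'c set \<Rightarrow> ('c \<Rightarrow> 'c) set" where
  "pointwise_stabilizer G F = {g \<in> carrier G. \<forall>x \<in> F. g x = x}"

text \<open>
  For a group \<open>G\<close> of permutations of \<open>X\<close>: the group topology in which the pointwise
  stabilizers of finite subsets of \<open>X\<close> form a basis of neighbourhoods of the identity.
\<close>

definition permutation_topology ::
    "'c set \<Rightarrow> ('c \<Rightarrow> 'c, 'm) monoid_scheme \<Rightarrow> ('c \<Rightarrow> 'c) topology" where
  "permutation_topology X G = topology (\<lambda>U. U \<subseteq> carrier G \<and>
     (\<forall>g \<in> U. \<exists>F. finite F \<and> F \<subseteq> X \<and> g <#\<^bsub>G\<^esub> pointwise_stabilizer G F \<subseteq> U))"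

definition topological_group :: "('g, 'm) monoid_scheme \<Rightarrow> 'g topology \<Rightarrow> bool" where
  "topological_group G T \<longleftrightarrow> group G \<and> topspace T = carrier G \<and>
     continuous_map (prod_topology T T) T (\<lambda>(x, y). x \<otimes>\<^bsub>G\<^esub> y) \<and>
     continuous_map T T (\<lambda>x. inv\<^bsub>G\<^esub> x)"

definition noetherian_group :: "('g, 'm) monoid_scheme \<Rightarrow> 'g topology \<Rightarrow> bool" where
  "noetherian_group G T \<longleftrightarrow> topological_group G T \<and>
     (\<forall>H :: nat \<Rightarrow> 'g set.
        (\<forall>n. subgroup (H n) G \<and> openin T (H n) \<and> H n \<subseteq> H (Suc n)) \<longrightarrow>
        (\<exists>N. \<forall>n \<ge> N. H n = H N))"

section \<open>Basic facts about the automorphism group\<close>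

lemma openin_permutation_topology:
  "openin (permutation_topology X G) U \<longleftrightarrow> U \<subseteq> carrier G \<and>
     (\<forall>g \<in> U. \<exists>F. finite F \<and> F \<subseteq> X \<and> g <#\<^bsub>G\<^esub> pointwise_stabilizer G F \<subseteq> U)"
proof -
  let ?st = "pointwise_stabilizer G"
  let ?L = "\<lambda>U. U \<subseteq> carrier G \<and>
     (\<forall>g \<in> U. \<exists>F. finite F \<and> F \<subseteq> X \<and> g <#\<^bsub>G\<^esub> ?st F \<subseteq> U)"
  have mono: "g <#\<^bsub>G\<^esub> ?st (F1 \<union> F2) \<subseteq> (g <#\<^bsub>G\<^esub> ?st F1) \<inter> (g <#\<^bsub>G\<^esub> ?st F2)" for g F1 F2
    by (auto simp: l_coset_def pointwise_stabilizer_def)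
  have int: "?L (A \<inter> B)" if A: "?L A" and B: "?L B" for A B
  proof (intro conjI ballI)
    show "A \<inter> B \<subseteq> carrier G" using A by blast
    fix g assume g: "g \<in> A \<inter> B"
    obtain F1 where F1: "finite F1" "F1 \<subseteq> X" "g <#\<^bsub>G\<^esub> ?st F1 \<subseteq> A" using A g by blast
    obtain F2 where F2: "finite F2" "F2 \<subseteq> X" "g <#\<^bsub>G\<^esub> ?st F2 \<subseteq> B" using B g by blast
    have "finite (F1 \<union> F2) \<and> F1 \<union> F2 \<subseteq> X \<and> g <#\<^bsub>G\<^esub> ?st (F1 \<union> F2) \<subseteq> A \<inter> B"
      using F1 F2 mono[of g F1 F2] by blast
    then show "\<exists>F. finite F \<and> F \<subseteq> X \<and> g <#\<^bsub>G\<^esub> ?st F \<subseteq> A \<inter> B" by blast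
  qed
  have un: "?L (\<Union>K)" if K: "\<forall>A \<in> K. ?L A" for K
  proof (intro conjI ballI)
    show "\<Union>K \<subseteq> carrier G" using K by blast
    fix g assume "g \<in> \<Union>K"
    then obtain A where A: "A \<in> K" "g \<in> A" by (rule UnionE)
    have "?L A" using K A(1) by (rule bspec)
    then have "\<exists>F. finite F \<and> F \<subseteq> X \<and> g <#\<^bsub>G\<^esub> ?st F \<subseteq> A" using A(2) by simp
    then show "\<exists>F. finite F \<and> F \<subseteq> X \<and> g <#\<^bsub>G\<^esub> ?st F \<subseteq> \<Union>K"
      using Union_upper[OF A(1)] by (meson subset_trans)
  qed
  have "istopology ?L"
    unfolding istopology_def using int un by (intro conjI allI impI) simp_all
  then show ?thesis
    unfolding permutation_topology_def by (simp add: topology_inverse')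
qed

lemma Aut_carrier:
  "g \<in> carrier (Aut \<Delta>) \<longleftrightarrow> g \<in> Bij (chambers \<Delta>) \<and>
    (\<forall>s. \<forall>x \<in> chambers \<Delta>. \<forall>y \<in> chambers \<Delta>. adjacent \<Delta> s (g x) (g y) \<longleftrightarrow> adjacent \<Delta> s x y)"
  by (simp add: Aut_def)

lemma Aut_mult:
  "\<lbrakk>g \<in> carrier (Aut \<Delta>); h \<in> carrier (Aut \<Delta>)\<rbrakk> \<Longrightarrow> g \<otimes>\<^bsub>Aut \<Delta>\<^esub> h = compose (chambers \<Delta>) g h"
  by (simp add: Aut_def BijGroup_def)

lemma Aut_one: "\<one>\<^bsub>Aut \<Delta>\<^esub> = (\<lambda>x \<in> chambers \<Delta>. x)"
  by (simp add: Aut_def BijGroup_def)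

lemma Aut_closed: "\<lbrakk>g \<in> carrier (Aut \<Delta>); x \<in> chambers \<Delta>\<rbrakk> \<Longrightarrow> g x \<in> chambers \<Delta>"
  by (auto simp: Aut_carrier dest: Bij_imp_funcset)

lemma group_Aut: "group (Aut \<Delta>)"
proof (rule groupI)
  let ?C = "chambers \<Delta>"
  fix g h assume g: "g \<in> carrier (Aut \<Delta>)" and h: "h \<in> carrier (Aut \<Delta>)"
  show gh: "g \<otimes>\<^bsub>Aut \<Delta>\<^esub> h \<in> carrier (Aut \<Delta>)"
    using g h Aut_closed[OF h]
    by (simp add: Aut_mult) (simp add: Aut_carrier compose_Bij compose_eq)
  fix k assume k: "k \<in> carrier (Aut \<Delta>)"
  have hk: "h \<otimes>\<^bsub>Aut \<Delta>\<^esub> k \<in> carrier (Aut \<Delta>)"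
    using h k Aut_closed[OF k]
    by (simp add: Aut_mult) (simp add: Aut_carrier compose_Bij compose_eq)
  have "k \<in> ?C \<rightarrow> ?C" using Aut_closed[OF k] by blast
  with g h k gh hk show
    "g \<otimes>\<^bsub>Aut \<Delta>\<^esub> h \<otimes>\<^bsub>Aut \<Delta>\<^esub> k = g \<otimes>\<^bsub>Aut \<Delta>\<^esub> (h \<otimes>\<^bsub>Aut \<Delta>\<^esub> k)"
    by (auto simp: Aut_mult compose_def Aut_closed restrict_def fun_eq_iff)
next
  show one: "\<one>\<^bsub>Aut \<Delta>\<^esub> \<in> carrier (Aut \<Delta>)"
    by (simp add: Aut_carrier Aut_one id_Bij)
  fix g assume g: "g \<in> carrier (Aut \<Delta>)"
  let ?C = "chambers \<Delta>"
  have gB: "g \<in> Bij ?C" using g by (simp add: Aut_carrier)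
  show "\<one>\<^bsub>Aut \<Delta>\<^esub> \<otimes>\<^bsub>Aut \<Delta>\<^esub> g = g"
    using Aut_mult[OF one g] gB
    by (simp add: Aut_one Bij_imp_funcset Bij_imp_extensional)
  let ?h = "\<lambda>x \<in> ?C. inv_into ?C g x"
  have hB: "?h \<in> Bij ?C" by (rule restrict_inv_into_Bij[OF gB])
  have inv: "g (?h x) = x" "?h x \<in> ?C" if "x \<in> ?C" for x
    using gB that by (auto simp: Bij_def bij_betw_def f_inv_into_f inv_into_into)
  have h: "?h \<in> carrier (Aut \<Delta>)"
    unfolding Aut_carrier
  proof (intro conjI allI ballI)
    fix s x y assume x: "x \<in> ?C" and y: "y \<in> ?C"
    have "adjacent \<Delta> s (g (?h x)) (g (?h y)) \<longleftrightarrow> adjacent \<Delta> s (?h x) (?h y)"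
      using g inv(2)[OF x] inv(2)[OF y] by (simp add: Aut_carrier)
    then show "adjacent \<Delta> s (?h x) (?h y) \<longleftrightarrow> adjacent \<Delta> s x y"
      by (simp only: inv(1)[OF x] inv(1)[OF y])
  qed (rule hB)
  have "?h \<otimes>\<^bsub>Aut \<Delta>\<^esub> g = \<one>\<^bsub>Aut \<Delta>\<^esub>"
    using Bij_compose_restrict_eq[OF gB] by (simp only: Aut_mult[OF h g] Aut_one)
  then show "\<exists>h \<in> carrier (Aut \<Delta>). h \<otimes>\<^bsub>Aut \<Delta>\<^esub> g = \<one>\<^bsub>Aut \<Delta>\<^esub>"
    using h by blast
qed

lemma Aut_mult_apply:
  "\<lbrakk>g \<in> carrier (Aut \<Delta>); h \<in> carrier (Aut \<Delta>); x \<in> chambers \<Delta>\<rbrakk> \<Longrightarrow> (g \<otimes>\<^bsub>Aut \<Delta>\<^esub> h) x = g (h x)"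
  by (simp add: Aut_mult compose_eq)

lemma Aut_inv_apply:
  assumes "g \<in> carrier (Aut \<Delta>)" "x \<in> chambers \<Delta>"
  shows "(inv\<^bsub>Aut \<Delta>\<^esub> g) (g x) = x" "g ((inv\<^bsub>Aut \<Delta>\<^esub> g) x) = x"
proof -
  interpret group "Aut \<Delta>" by (rule group_Aut)
  show "(inv\<^bsub>Aut \<Delta>\<^esub> g) (g x) = x"
    using assms Aut_mult_apply[of "inv\<^bsub>Aut \<Delta>\<^esub> g" \<Delta> g x] by (simp add: Aut_one)
  show "g ((inv\<^bsub>Aut \<Delta>\<^esub> g) x) = x"
    using assms Aut_mult_apply[of g \<Delta> "inv\<^bsub>Aut \<Delta>\<^esub> g" x] by (simp add: Aut_one)
qed

lemma Aut_coset_stabilizer: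
  assumes g: "g \<in> carrier (Aut \<Delta>)" and F: "F \<subseteq> chambers \<Delta>"
  shows "g <#\<^bsub>Aut \<Delta>\<^esub> pointwise_stabilizer (Aut \<Delta>) F =
    {h \<in> carrier (Aut \<Delta>). \<forall>x \<in> F. h x = g x}" (is "?L = ?R")
proof
  interpret group "Aut \<Delta>" by (rule group_Aut)
  show "?L \<subseteq> ?R"
    using g F by (auto simp: l_coset_def pointwise_stabilizer_def Aut_mult_apply subset_iff)
  show "?R \<subseteq> ?L"
  proof
    fix h assume h: "h \<in> ?R"
    let ?k = "inv\<^bsub>Aut \<Delta>\<^esub> g \<otimes>\<^bsub>Aut \<Delta>\<^esub> h"
    have "?k x = x" if "x \<in> F" for x
      using h g F that Aut_mult_apply[of "inv\<^bsub>Aut \<Delta>\<^esub> g" \<Delta> h x] Aut_inv_apply(1)[of g \<Delta> x]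
      by (auto simp: subset_iff)
    then have "?k \<in> pointwise_stabilizer (Aut \<Delta>) F"
      using g h by (simp add: pointwise_stabilizer_def)
    moreover have "h = g \<otimes>\<^bsub>Aut \<Delta>\<^esub> ?k"
      using g h by (simp add: m_assoc[symmetric])
    ultimately show "h \<in> ?L" unfolding l_coset_def by blast
  qed
qed

lemma openin_Aut:
  "openin (permutation_topology (chambers \<Delta>) (Aut \<Delta>)) U \<longleftrightarrow> U \<subseteq> carrier (Aut \<Delta>) \<and>
     (\<forall>g \<in> U. \<exists>F. finite F \<and> F \<subseteq> chambers \<Delta> \<and>
        (\<forall>h \<in> carrier (Aut \<Delta>). (\<forall>x \<in> F. h x = g x) \<longrightarrow> h \<in> U))"
proof (cases "U \<subseteq> carrier (Aut \<Delta>)")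
  case True
  have "g <#\<^bsub>Aut \<Delta>\<^esub> pointwise_stabilizer (Aut \<Delta>) F \<subseteq> U \<longleftrightarrow>
      (\<forall>h \<in> carrier (Aut \<Delta>). (\<forall>x \<in> F. h x = g x) \<longrightarrow> h \<in> U)"
    if "g \<in> U" "F \<subseteq> chambers \<Delta>" for g F
    using Aut_coset_stabilizer[of g \<Delta> F] that True by (auto simp: subset_iff)
  then show ?thesis
    unfolding openin_permutation_topology by (auto cong: conj_cong)
qed (simp add: openin_permutation_topology)

lemma topspace_Aut: "topspace (permutation_topology (chambers \<Delta>) (Aut \<Delta>)) = carrier (Aut \<Delta>)"
proof -
  have "openin (permutation_topology (chambers \<Delta>) (Aut \<Delta>)) (carrier (Aut \<Delta>))"
    unfolding openin_Aut by blast
  moreover have "U \<subseteq> carrier (Aut \<Delta>)"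
    if "openin (permutation_topology (chambers \<Delta>) (Aut \<Delta>)) U" for U
    using that unfolding openin_Aut by blast
  ultimately show ?thesis
    by (meson openin_subset openin_topspace subset_antisym)
qed

lemma openin_Aut_agree:
  assumes "finite F" "F \<subseteq> chambers \<Delta>"
  shows "openin (permutation_topology (chambers \<Delta>) (Aut \<Delta>))
    {h \<in> carrier (Aut \<Delta>). \<forall>x \<in> F. h x = g x}"
  unfolding openin_Aut using assms by (intro conjI ballI exI[of _ F]) auto

lemma topological_group_Aut:
  "topological_group (Aut \<Delta>) (permutation_topology (chambers \<Delta>) (Aut \<Delta>))"
proof -
  let ?G = "Aut \<Delta>" and ?C = "chambers \<Delta>"
  let ?T = "permutation_topology ?C ?G"
  interpret group ?G by (rule group_Aut)
  have "continuous_map (prod_topology ?T ?T) ?T (\<lambda>(x, y). x \<otimes>\<^bsub>?G\<^esub> y)"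
    unfolding continuous_map_def
  proof (intro conjI allI impI)
    show "(\<lambda>(x, y). x \<otimes>\<^bsub>?G\<^esub> y) \<in> topspace (prod_topology ?T ?T) \<rightarrow> topspace ?T"
      by (auto simp: topspace_Aut)
    fix U assume U: "openin ?T U"
    let ?A = "\<lambda>F g. {h \<in> carrier ?G. \<forall>x \<in> F. h x = g x}"
    show "openin (prod_topology ?T ?T)
      {x \<in> topspace (prod_topology ?T ?T). (case x of (x, y) \<Rightarrow> x \<otimes>\<^bsub>?G\<^esub> y) \<in> U}" (is "openin _ ?V")
      unfolding openin_prod_topology_alt
    proof (intro allI impI)
      fix g h assume "(g, h) \<in> ?V"
      then have gh: "g \<in> carrier ?G" "h \<in> carrier ?G" "g \<otimes>\<^bsub>?G\<^esub> h \<in> U"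
        by (auto simp: topspace_Aut)
      obtain F where F: "finite F" "F \<subseteq> ?C"
        "\<And>k. \<lbrakk>k \<in> carrier ?G; \<forall>x \<in> F. k x = (g \<otimes>\<^bsub>?G\<^esub> h) x\<rbrakk> \<Longrightarrow> k \<in> U"
        using U gh(3) unfolding openin_Aut by metis
      have hF: "h ` F \<subseteq> ?C" using F(2) Aut_closed[OF gh(2)] by auto
      have "?A (h ` F) g \<times> ?A F h \<subseteq> ?V"
      proof
        fix p assume "p \<in> ?A (h ` F) g \<times> ?A F h"
        then obtain a b where p: "p = (a, b)" and ab: "a \<in> carrier ?G" "\<forall>x \<in> h ` F. a x = g x"
          "b \<in> carrier ?G" "\<forall>x \<in> F. b x = h x"
          by blast
        have "a \<otimes>\<^bsub>?G\<^esub> b \<in> U"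
          using ab gh F(2) by (intro F(3)) (auto simp: Aut_mult_apply subset_iff)
        then show "p \<in> ?V"
          using ab p by (simp add: topspace_Aut)
      qed
      moreover have "openin ?T (?A (h ` F) g)" "openin ?T (?A F h)"
        using openin_Aut_agree[of "h ` F" \<Delta> g] openin_Aut_agree[of F \<Delta> h] F hF by simp_all
      ultimately show "\<exists>A B. openin ?T A \<and> openin ?T B \<and> g \<in> A \<and> h \<in> B \<and> A \<times> B \<subseteq> ?V"
        using gh by (intro exI[of _ "?A (h ` F) g"] exI[of _ "?A F h"]) simp
    qed
  qed
  moreover have "continuous_map ?T ?T (\<lambda>x. inv\<^bsub>?G\<^esub> x)"
    unfolding continuous_map_def
  proof (intro conjI allI impI)
    show "(\<lambda>x. inv\<^bsub>?G\<^esub> x) \<in> topspace ?T \<rightarrow> topspace ?T"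
      by (simp add: topspace_Aut)
    fix U assume U: "openin ?T U"
    show "openin ?T {x \<in> topspace ?T. inv\<^bsub>?G\<^esub> x \<in> U}" (is "openin _ ?V")
      unfolding openin_Aut
    proof (intro conjI ballI)
      show "?V \<subseteq> carrier ?G" by (auto simp: topspace_Aut)
      fix g assume "g \<in> ?V"
      then have g: "g \<in> carrier ?G" "inv\<^bsub>?G\<^esub> g \<in> U" by (auto simp: topspace_Aut)
      obtain F where F: "finite F" "F \<subseteq> ?C"
        "\<And>k. \<lbrakk>k \<in> carrier ?G; \<forall>x \<in> F. k x = (inv\<^bsub>?G\<^esub> g) x\<rbrakk> \<Longrightarrow> k \<in> U"
        using U g(2) unfolding openin_Aut by metis
      let ?F = "(inv\<^bsub>?G\<^esub> g) ` F"
      have FC: "?F \<subseteq> ?C" using F(2) Aut_closed[OF inv_closed[OF g(1)]] by auto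
      have "h \<in> ?V" if h: "h \<in> carrier ?G" "\<forall>x \<in> ?F. h x = g x" for h
      proof -
        have "(inv\<^bsub>?G\<^esub> h) x = (inv\<^bsub>?G\<^esub> g) x" if x: "x \<in> F" for x
        proof -
          have "h ((inv\<^bsub>?G\<^esub> g) x) = x"
            using h(2) x Aut_inv_apply(2)[OF g(1), of x] F(2) by auto
          then show ?thesis
            using Aut_inv_apply(1)[OF h(1), of "(inv\<^bsub>?G\<^esub> g) x"] FC x by auto
        qed
        then show ?thesis using F(3)[of "inv\<^bsub>?G\<^esub> h"] h(1) by (simp add: topspace_Aut)
      qed
      then show "\<exists>F. finite F \<and> F \<subseteq> ?C \<and>
          (\<forall>h \<in> carrier ?G. (\<forall>x \<in> F. h x = g x) \<longrightarrow> h \<in> ?V)"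
        using F(1) FC by (intro exI[of _ ?F]) simp
    qed
  qed
  ultimately show ?thesis
    unfolding topological_group_def by (simp add: topspace_Aut group_Aut)
qed

end

theory Submission
  imports Defs "HOL-Combinatorics.Transposition"
begin

text \<open>
  Let \<open>H\<^sub>0 \<subseteq> H\<^sub>1 \<subseteq> \<dots>\<close> be open subgroups with union \<open>U\<close>, and let \<open>F\<close> be a finite set of chambers,
  containing a chamber \<open>c\<close>, whose pointwise stabilizer lies in \<open>H\<^sub>0\<close>. The point is that the orbit
  \<open>U c\<close> is coarsely connected: if \<open>g c\<close> is far from \<open>c\<close>, then some \<open>h c\<close> with \<open>h \<in> U\<close> is closer to
  both \<open>c\<close> and \<open>g c\<close> than these are to each other (\<open>intermediate_orbit_point\<close>). By induction on the
  distance, \<open>U\<close> is generated by its elements that move \<open>c\<close> a bounded distance. By local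
  finiteness those form finitely many cosets of the stabilizer of \<open>F\<close>, so all of them lie in one
  \<open>H\<^sub>N\<close>, and the chain is constant from there on (\<open>noetherian_chain\<close>).

  To find \<open>h\<close>, call \<^emph>\<open>wall\<close> of type \<open>s\<close> a residue of type \<open>s\<close> together with the generators commuting
  with \<open>s\<close>. Removing the \<open>s\<close>-edges of a wall splits the building into \<^emph>\<open>wings\<close>, one for each chamber of
  an \<open>s\<close>-panel of the wall. A minimal gallery from \<open>c\<close> to \<open>g c\<close> crosses every wall at most once
  (\<open>irreducible_path_crosses_once\<close>), and only a bounded number of walls separate two chambers of \<open>F\<close> or
  of \<open>g F\<close>. So if the gallery is long, it has a step \<open>a\<close>, \<open>b\<close> away from its middle whose wall
  has \<open>F\<close> in the wing of \<open>a\<close> and \<open>g F\<close> in the wing of \<open>b\<close>. Let \<open>z\<close> be a third chamber of the panel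
  of \<open>a\<close> and \<open>b\<close>. There are automorphisms \<open>\<alpha>\<close> fixing the wing of \<open>a\<close> and \<open>\<beta>\<close> fixing the wing of \<open>b\<close> with
  \<open>\<alpha> b = z = \<beta> a\<close>. They fix \<open>F\<close> and \<open>g F\<close> respectively, so both lie in \<open>U\<close>, and \<open>r = \<alpha>\<inverse> \<beta>\<close> maps \<open>a\<close> to \<open>b\<close>
  (\<open>crossing_element\<close>). Folding the gallery with \<open>r\<close> gives \<open>h = r\<close> if the step lies in the first half
  and \<open>h = r\<inverse> g\<close> if it lies in the second half.

  The automorphisms \<open>\<alpha>\<close> and \<open>\<beta>\<close> come from \<open>wing_automorphism\<close>. Colour the chambers of all \<open>s\<close>-panels by
  residues modulo their common size, in such a way that parallel panels are coloured alike. Rotating the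
  colours gives commuting permutations for commuting types, and a word in these
  rotations that fixes one chamber for one colouring fixes every chamber for every colouring
  (\<open>closed_walk_transfer\<close>). Hence for any two systems of colourings there is an automorphism that
  intertwines the rotations and has a prescribed value at one chamber. If the second system exchanges
  the colours of \<open>b\<close> and \<open>z\<close> on one wall only, the automorphism that fixes \<open>a\<close> fixes the whole wing of \<open>a\<close>
  and maps \<open>b\<close> to \<open>z\<close>.

  All this rests on the solution of the word problem in right-angled Coxeter groups: a word is reduced
  as soon as no two equal letters can be brought together by interchanging commuting neighbours
  (\<open>irreducible_words_equal\<close>).
\<close>

lemma append_eq_append_Cons_cases:
  assumes "a @ b = x @ t # z"
  obtains us where "a = x @ t # us" "z = us @ b" | us where "x = a @ us" "b = us @ t # z"
proof -
  from assms obtain us where "a = x @ us \<and> us @ b = t # z \<or> a @ us = x \<and> b = us @ t # z"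
    unfolding append_eq_append_conv2 by blast
  then show thesis using that by (cases us) auto
qed

section \<open>Words with partial commutation\<close>

text \<open>In the application \<open>indep\<close> holds between distinct commuting generators.\<close>

locale partial_commutation =
  fixes indep :: "'a \<Rightarrow> 'a \<Rightarrow> bool"
  assumes indep_sym: "indep s t \<Longrightarrow> indep t s"
    and indep_irrefl: "\<not> indep s s"
begin

text \<open>In a reducible word the second \<open>s\<close> can be moved next to the first one, where the two cancel or merge.\<close>

definition irreducible_word :: "'a list \<Rightarrow> bool" where
  "irreducible_word w \<longleftrightarrow> \<not> (\<exists>a s b e. w = a @ s # b @ s # e \<and> (\<forall>t \<in> set b. indep s t))"

text \<open>
  Two words can be transformed into each other by interchanging independent neighbours if and only if
  they have the same projections onto all sets \<open>{x, y}\<close> of dependent letters. So \<open>projections w\<close>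
  stands for the class of \<open>w\<close> under such interchanges and no quotient has to be formed. The
  pairs \<open>(s, s)\<close> are included: they count the occurrences of each letter.
\<close>

definition projections :: "'a list \<Rightarrow> 'a \<times> 'a \<Rightarrow> 'a list" where
  "projections w = (\<lambda>(x, y). if indep x y then [] else filter (\<lambda>u. u = x \<or> u = y) w)"

definition removable :: "'a \<Rightarrow> ('a \<times> 'a \<Rightarrow> 'a list) \<Rightarrow> bool" where
  "removable s f \<longleftrightarrow> (\<forall>t. \<not> indep s t \<longrightarrow> f (s, t) \<noteq> [] \<and> last (f (s, t)) = s)"

text \<open>
  This is right multiplication by the generator \<open>s\<close> on normal forms: a last letter \<open>s\<close> is cancelled if there is
  one, otherwise \<open>s\<close> is appended.
\<close>

definition letter_action :: "'a \<Rightarrow> ('a \<times> 'a \<Rightarrow> 'a list) \<Rightarrow> 'a \<times> 'a \<Rightarrow> 'a list" where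
  "letter_action s f = (\<lambda>(x, y).
     if (x = s \<or> y = s) \<and> \<not> indep x y
     then if removable s f then butlast (f (x, y)) else f (x, y) @ [s]
     else f (x, y))"

lemma irreducible_Nil: "irreducible_word []"
  by (simp add: irreducible_word_def)

lemma irreducible_singleton: "irreducible_word [s]"
  by (auto simp: irreducible_word_def Cons_eq_append_conv)

lemma irreducible_pair: "s \<noteq> t \<Longrightarrow> irreducible_word [s, t]"
  by (auto simp: irreducible_word_def Cons_eq_append_conv)

lemma irreducible_butlast: "irreducible_word (w @ [s]) \<Longrightarrow> irreducible_word w"
  unfolding irreducible_word_def
proof (elim contrapos_nn exE conjE)
  fix a t b e assume "w = a @ t # b @ t # e" "\<forall>u \<in> set b. indep t u"
  then show "\<exists>a t b e. w @ [s] = a @ t # b @ t # e \<and> (\<forall>u \<in> set b. indep t u)"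
    by (intro exI[of _ a] exI[of _ t] exI[of _ b] exI[of _ "e @ [s]"]) simp
qed

lemma irreducible_factor:
  assumes "irreducible_word (a @ u @ b)"
  shows "irreducible_word u"
  unfolding irreducible_word_def
proof (intro notI, elim exE conjE)
  fix x s y z assume "u = x @ s # y @ s # z" "\<forall>t \<in> set y. indep s t"
  then have "a @ u @ b = (a @ x) @ s # y @ s # (z @ b)" "\<forall>t \<in> set y. indep s t" by simp_all
  then show False using assms unfolding irreducible_word_def by blast
qed

lemma projections_append_letter:
  "projections (w @ [s]) = (\<lambda>(x, y). if (x = s \<or> y = s) \<and> \<not> indep x y
     then projections w (x, y) @ [s] else projections w (x, y))"
  by (auto simp: projections_def fun_eq_iff)

text \<open>
  If \<open>s\<close> is the last letter of every projection that involves \<open>s\<close>, then a letter behind the last \<open>s\<close>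
  that depends on \<open>s\<close> would be seen in the projection onto these two letters.
\<close>

lemma removable_projections_iff:
  "removable s (projections w) \<longleftrightarrow> (\<exists>a b. w = a @ s # b \<and> (\<forall>t \<in> set b. indep s t))"
proof
  assume r: "removable s (projections w)"
  then have "filter (\<lambda>u. u = s \<or> u = s) w \<noteq> []"
    using indep_irrefl[of s] unfolding removable_def projections_def by fastforce
  then have "s \<in> set w" by (auto simp: filter_empty_conv)
  then obtain a b where w: "w = a @ s # b" and b: "s \<notin> set b" by (meson split_list_last)
  have "indep s t" if t: "t \<in> set b" for t
  proof (rule ccontr)
    assume n: "\<not> indep s t"
    let ?P = "\<lambda>u. u = s \<or> u = t"
    have "filter ?P b \<noteq> []" using t by (auto simp: filter_empty_conv)
    then have "last (filter ?P w) \<in> set (filter ?P b)"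
      using last_in_set[of "filter ?P b"] by (simp add: w)
    then have "last (filter ?P w) \<noteq> s" using b by auto
    then show False using r n unfolding removable_def projections_def by auto
  qed
  then show "\<exists>a b. w = a @ s # b \<and> (\<forall>t \<in> set b. indep s t)" using w by blast
next
  assume "\<exists>a b. w = a @ s # b \<and> (\<forall>t \<in> set b. indep s t)"
  then obtain a b where w: "w = a @ s # b" and b: "\<forall>t \<in> set b. indep s t" by blast
  have "filter (\<lambda>u. u = s \<or> u = t) b = []" if "\<not> indep s t" for t
    using b that indep_irrefl by (auto simp: filter_empty_conv)
  then show "removable s (projections w)"
    unfolding removable_def projections_def w by simp
qed

lemma letter_action_append:
  assumes "irreducible_word w" "\<not> removable s (projections w)"
  shows "irreducible_word (w @ [s])" "letter_action s (projections w) = projections (w @ [s])"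
proof -
  show "irreducible_word (w @ [s])"
    unfolding irreducible_word_def
  proof clarify
    fix a t b e assume eq: "w @ [s] = a @ t # b @ t # e" and b: "\<forall>u \<in> set b. indep t u"
    show False
    proof (cases e rule: rev_cases)
      case Nil
      then have "w = a @ t # b" "t = s" using eq by (simp_all flip: append_assoc append_Cons)
      then show False using assms(2) b by (auto simp: removable_projections_iff)
    next
      case (snoc e' u)
      then have "w = a @ t # b @ t # e'" using eq by (simp flip: append_assoc append_Cons)
      then show False using assms(1) b unfolding irreducible_word_def by blast
    qed
  qed
  show "letter_action s (projections w) = projections (w @ [s])"
    unfolding projections_append_letter letter_action_def using assms(2) by (auto simp: fun_eq_iff)
qed

text \<open>
  Deleting an \<open>s\<close> that can be moved to the end leaves an irreducible word: a reducible pair of the shorter word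
  encloses, after reinsertion of \<open>s\<close>, at most this \<open>s\<close> in addition, and in that case the right letter of the pair
  stands in \<open>b\<close> and is independent of \<open>s\<close>. The last two conclusions make cancelling and appending
  inverse to each other.
\<close>

lemma letter_action_delete:
  assumes irr: "irreducible_word (a @ s # b)" and b: "\<forall>t \<in> set b. indep s t"
  shows "irreducible_word (a @ b)"
    "letter_action s (projections (a @ s # b)) = projections (a @ b)"
    "\<not> removable s (projections (a @ b))"
    "projections (a @ b @ [s]) = projections (a @ s # b)"
proof -
  have sb: "s \<notin> set b" using b indep_irrefl by blast
  have fb: "filter (\<lambda>u. u = x \<or> u = y) b = []" if "x = s \<or> y = s" "\<not> indep x y" for x y
    unfolding filter_empty_conv using b that indep_irrefl indep_sym by metis
  show "projections (a @ b @ [s]) = projections (a @ s # b)"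
    using fb by (auto simp: projections_def fun_eq_iff)
  have rem: "removable s (projections (a @ s # b))"
    unfolding removable_projections_iff using b by blast
  show "letter_action s (projections (a @ s # b)) = projections (a @ b)"
    unfolding letter_action_def using rem fb
    by (auto simp: projections_def fun_eq_iff butlast_append)
  show "irreducible_word (a @ b)"
    unfolding irreducible_word_def
  proof clarify
    fix x t y z assume eq: "a @ b = x @ t # y @ t # z" and y: "\<forall>u \<in> set y. indep t u"
    have no: "\<And>x t y z. a @ s # b = x @ t # y @ t # z \<Longrightarrow> \<forall>u \<in> set y. indep t u \<Longrightarrow> False"
      using irr unfolding irreducible_word_def by blast
    from eq show False
    proof (cases rule: append_eq_append_Cons_cases)
      case (2 us)
      then show False using no[of "a @ s # us" t y z] y by simp
    next
      case (1 us)
      from 1(2)[symmetric] show False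
      proof (cases rule: append_eq_append_Cons_cases)
        case (1 vs)
        then show False using no[of x t y "vs @ s # b"] y \<open>a = x @ t # us\<close> by simp
      next
        case (2 vs)
        have "indep t s" using b 2(2) by (simp add: indep_sym)
        then show False using no[of x t "us @ s # vs" z] y \<open>a = x @ t # us\<close> 2 by simp
      qed
    qed
  qed
  show "\<not> removable s (projections (a @ b))"
  proof
    assume "removable s (projections (a @ b))"
    then obtain x y where eq: "a @ b = x @ s # y" and y: "\<forall>t \<in> set y. indep s t"
      unfolding removable_projections_iff by blast
    from eq sb obtain us where "a = x @ s # us" "us @ b = y"
      by (cases rule: append_eq_append_Cons_cases) auto
    then have "a @ s # b = x @ s # us @ s # b" "\<forall>t \<in> set us. indep s t" using y by auto
    then show False using irr unfolding irreducible_word_def by blast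
  qed
qed

lemma letter_action_projections:
  assumes "irreducible_word w"
  obtains w' where "irreducible_word w'" "letter_action s (projections w) = projections w'"
    "length w' \<le> Suc (length w)" "letter_action s (projections w') = projections w"
proof (cases "removable s (projections w)")
  case True
  then obtain a b where w: "w = a @ s # b" and b: "\<forall>t \<in> set b. indep s t"
    unfolding removable_projections_iff by blast
  note d = letter_action_delete[OF assms[unfolded w] b]
  have "letter_action s (projections (a @ b)) = projections w"
    using letter_action_append(2)[OF d(1,3)] d(4) w by simp
  then show ?thesis using that[of "a @ b"] d w by simp
next
  case False
  note d = letter_action_append[OF assms False]
  have "letter_action s (projections (w @ [s])) = projections w"
    using letter_action_delete(2)[of w s "[]"] d(1) by simp
  then show ?thesis using that[of "w @ [s]"] d by simp
qed

text \<open>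
  The action of \<open>s\<close> reads and changes only projections that involve \<open>s\<close>. No pair of dependent letters
  contains both of two independent letters, so the two actions take place at disjoint coordinates.
\<close>

lemma letter_action_commute:
  assumes "indep s t"
  shows "letter_action s (letter_action t f) = letter_action t (letter_action s f)"
proof -
  have st: "s \<noteq> t" "\<not> indep s s" "\<not> indep t t" "indep t s"
    using assms indep_irrefl indep_sym by metis+
  have keep: "removable x (letter_action y f) \<longleftrightarrow> removable x f" if xy: "indep x y" "x \<noteq> y" for x y
  proof -
    have "letter_action y f (x, u) = f (x, u)" if "\<not> indep x u" for u
      using xy that by (auto simp: letter_action_def)
    then show ?thesis by (simp add: removable_def)
  qed
  have "letter_action s (letter_action t f) (x, y) = letter_action t (letter_action s f) (x, y)" for x y
    unfolding letter_action_def[of s "letter_action t f"] letter_action_def[of t "letter_action s f"]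
      keep[OF assms st(1)] keep[OF st(4) st(1)[symmetric]]
    using assms st by (auto simp: letter_action_def)
  then show ?thesis by (simp add: fun_eq_iff split_paired_all)
qed

definition word_action :: "'a list \<Rightarrow> ('a \<times> 'a \<Rightarrow> 'a list) \<Rightarrow> 'a \<times> 'a \<Rightarrow> 'a list" where
  "word_action w f = fold letter_action w f"

lemma word_action_append: "word_action (u @ v) f = word_action v (word_action u f)"
  by (simp add: word_action_def)

lemma word_action_projections:
  assumes "irreducible_word w"
  obtains w' where "irreducible_word w'" "word_action u (projections w) = projections w'"
    "length w' \<le> length w + length u"
proof -
  have "\<exists>w'. irreducible_word w' \<and> word_action u (projections w) = projections w' \<and>
      length w' \<le> length w + length u"
    using assms
  proof (induction u arbitrary: w)
    case Nil
    then show ?case by (auto simp: word_action_def)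
  next
    case (Cons s u)
    obtain w1 where w1: "irreducible_word w1" "letter_action s (projections w) = projections w1"
      "length w1 \<le> Suc (length w)"
      using letter_action_projections[OF Cons.prems, of s] by blast
    obtain w' where "irreducible_word w'" "word_action u (projections w1) = projections w'"
      "length w' \<le> length w1 + length u"
      using Cons.IH[OF w1(1)] by blast
    then show ?case using w1 by (intro exI[of _ w']) (simp add: word_action_def)
  qed
  then show ?thesis using that by blast
qed

lemma word_action_irreducible:
  "irreducible_word w \<Longrightarrow> word_action w (projections []) = projections w"
proof (induction w rule: rev_induct)
  case (snoc s w)
  have w: "irreducible_word w" using snoc.prems by (rule irreducible_butlast)
  have "\<not> removable s (projections w)"
  proof
    assume "removable s (projections w)"
    then obtain a b where "w = a @ s # b" "\<forall>t \<in> set b. indep s t"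
      unfolding removable_projections_iff by blast
    then have "w @ [s] = a @ s # b @ s # []" "\<forall>t \<in> set b. indep s t" by simp_all
    then show False using snoc.prems unfolding irreducible_word_def by blast
  qed
  then show ?case
    using snoc.IH[OF w] letter_action_append(2)[OF w] by (simp add: word_action_def)
qed (simp add: word_action_def)

text \<open>The diagonal projections already determine how often each letter occurs.\<close>

lemma projections_eq_letters:
  assumes "projections u = projections v"
  shows "set u = set v" "length u = length v"
proof -
  have f: "filter (\<lambda>x. x = s) u = filter (\<lambda>x. x = s) v" for s
    using fun_cong[OF assms, of "(s, s)"] indep_irrefl by (simp add: projections_def)
  have "s \<in> set u \<longleftrightarrow> s \<in> set v" for s
    using arg_cong[OF f[of s], of set] by auto
  then show "set u = set v" by blast
  have "count_list u = count_list v"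
    using f by (simp add: fun_eq_iff count_list_eq_length_filter eq_commute)
  then show "length u = length v"
    using sum_count_set[of u "set u"] sum_count_set[of v "set u"] \<open>set u = set v\<close> by simp
qed

end

section \<open>The word problem in right-angled Coxeter groups\<close>

context right_angled_coxeter_system
begin

definition commutes :: "'a \<Rightarrow> 'a \<Rightarrow> bool" where
  "commutes s t \<longleftrightarrow> s \<in> S \<and> t \<in> S \<and> s \<noteq> t \<and> s \<otimes> t = t \<otimes> s"

sublocale partial_commutation commutes
  by unfold_locales (auto simp: commutes_def)

lemma generator_square: "s \<in> S \<Longrightarrow> s \<otimes> s = \<one>"
  using generators_order[of s] generators_closed pow_ord_eq_1[of s]
  by (auto simp: numeral_2_eq_2)

text \<open>So the Coxeter relations are generated by \<open>s s = 1\<close> and \<open>s t s t = 1\<close> for commuting \<open>s\<close> and \<open>t\<close>.\<close>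

lemma finite_matrix_entry:
  assumes "s \<in> S" "t \<in> S" "coxeter_matrix W s t = enat n"
  shows "n = 1 \<and> s = t \<or> n = 2 \<and> commutes s t"
proof -
  have c: "s \<in> carrier W" "t \<in> carrier W" using assms generators_closed by auto
  have n: "n = 1 \<or> n = 2" "ord (s \<otimes> t) = n"
    using right_angled[OF assms(1,2)] assms(3)
    by (auto simp: one_enat_def numeral_eq_enat coxeter_matrix_def Let_def split: if_splits)
  have sq: "s \<otimes> s = \<one>" "t \<otimes> t = \<one>" using generator_square assms by auto
  have pow: "(s \<otimes> t) [^] n = \<one>" using n(2) pow_ord_eq_1[of "s \<otimes> t"] c by simp
  show ?thesis
  proof (cases "n = 1")
    case True
    then have "s \<otimes> t = \<one>" using pow c by simp
    then have "inv t = s" using c by (simp add: inv_equality)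
    moreover have "inv t = t" using sq c by (simp add: inv_equality)
    ultimately show ?thesis using True by simp
  next
    case False
    then have n2: "n = 2" using n by simp
    have "(s \<otimes> t) \<otimes> (s \<otimes> t) = \<one>" using pow c n2 by (simp add: numeral_2_eq_2)
    then have "inv (s \<otimes> t) = s \<otimes> t" using c by (simp add: inv_equality)
    moreover have "inv s = s" "inv t = t" using sq c by (simp_all add: inv_equality)
    ultimately have "s \<otimes> t = t \<otimes> s" using c by (simp add: inv_mult_group)
    moreover have "s \<noteq> t" using n n2 sq ord_eq_1[of \<one>] by auto
    ultimately show ?thesis using assms n2 by (simp add: commutes_def)
  qed
qed

text \<open>
  On classes of irreducible words each letter acts as an involution and commuting letters act by commuting
  maps. By \<open>finite_matrix_entry\<close> no other relations have to be respected, so the group itself acts.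
\<close>

lemma word_action_coxeter_equiv:
  assumes "coxeter_equiv S (coxeter_matrix W) u v" "irreducible_word w"
  shows "word_action u (projections w) = word_action v (projections w)"
  using assms
proof (induction arbitrary: w rule: coxeter_equiv.induct)
  case (relator u v s t n)
  obtain w1 where w1: "irreducible_word w1" "word_action u (projections w) = projections w1"
    using word_action_projections[OF relator.prems] by blast
  have inv: "letter_action s (letter_action s (projections w')) = projections w'"
    if "irreducible_word w'" for w' s
    using letter_action_projections[OF that, of s] by metis
  have "word_action (concat (replicate n [s, t])) (projections w1) = projections w1"
    using finite_matrix_entry[OF relator(3-5)]
  proof (elim disjE conjE)
    assume "n = 1" "s = t"
    then show ?thesis using inv[OF w1(1)] by (simp add: word_action_def)
  next
    assume n: "n = 2" and st: "commutes s t"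
    obtain w2 where w2: "irreducible_word w2" "letter_action s (projections w1) = projections w2"
      "letter_action s (projections w2) = projections w1"
      using letter_action_projections[OF w1(1), of s] by blast
    show ?thesis
      using n inv w1(1) w2 letter_action_commute[OF st]
      by (simp add: word_action_def numeral_2_eq_2)
  qed
  then show ?case by (simp add: word_action_append w1(2))
qed auto

text \<open>
  Acting on the class of the empty word, an irreducible word produces its own class. By
  \<open>word_action_coxeter_equiv\<close> this class depends only on the group element, and any word \<open>v\<close> for this element produces it in
  \<open>length v\<close> steps, each of which adds at most one letter.
\<close>

lemma irreducible_words_equal:
  assumes "u \<in> lists S" "v \<in> lists S" "irreducible_word u" "word_eval W u = word_eval W v"
  shows "length u \<le> length v" "irreducible_word v \<Longrightarrow> set u = set v"
proof -
  have "coxeter_equiv S (coxeter_matrix W) u v" using presentation assms by blast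
  then have eq: "projections u = word_action v (projections [])"
    using word_action_coxeter_equiv[OF _ irreducible_Nil, of u v]
      word_action_irreducible[OF assms(3)] by simp
  obtain v' where "word_action v (projections []) = projections v'" "length v' \<le> length v"
    using word_action_projections[OF irreducible_Nil, of v] by auto
  then show "length u \<le> length v" using eq projections_eq_letters(2) by metis
  show "set u = set v" if "irreducible_word v"
    using eq word_action_irreducible[OF that] projections_eq_letters(1) by metis
qed

lemma irreducible_imp_reduced:
  "\<lbrakk>w \<in> lists S; irreducible_word w\<rbrakk> \<Longrightarrow> reduced_word W S w"
  unfolding reduced_word_def using irreducible_words_equal(1) by metis

lemma word_eval_closed: "w \<in> lists S \<Longrightarrow> word_eval W w \<in> carrier W"
  using generators_closed by (induction w) (auto simp: word_eval_def)

lemma word_eval_append: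
  "\<lbrakk>u \<in> lists S; v \<in> lists S\<rbrakk> \<Longrightarrow> word_eval W (u @ v) = word_eval W u \<otimes> word_eval W v"
  using generators_closed word_eval_closed
  by (induction u) (auto simp: word_eval_def m_assoc subset_iff)

lemma carrier_word_eval:
  assumes "x \<in> carrier W"
  obtains w where "w \<in> lists S" "word_eval W w = x"
proof -
  have "x \<in> generate W S" using assms generated by simp
  then have "\<exists>w \<in> lists S. word_eval W w = x"
  proof induction
    case one
    show ?case by (intro bexI[of _ "[]"]) (auto simp: word_eval_def)
  next
    case (incl s)
    then show ?case
      using generators_closed by (intro bexI[of _ "[s]"]) (auto simp: word_eval_def)
  next
    case (inv s)
    then have "inv s = s" using generator_square generators_closed by (auto intro!: inv_equality)
    then show ?case
      using inv generators_closed by (intro bexI[of _ "[s]"]) (auto simp: word_eval_def)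
  next
    case (eng x y)
    then show ?case using word_eval_append by (metis append_in_lists_conv)
  qed
  then show ?thesis using that by blast
qed

lemma carrier_reduced_word:
  assumes "x \<in> carrier W"
  obtains w where "reduced_word W S w" "word_eval W w = x"
proof -
  obtain v where v: "v \<in> lists S \<and> word_eval W v = x" using carrier_word_eval assms by metis
  obtain w where "w \<in> lists S \<and> word_eval W w = x"
    "\<forall>u. u \<in> lists S \<and> word_eval W u = x \<longrightarrow> length w \<le> length u"
    using ex_has_least_nat[of "\<lambda>w. w \<in> lists S \<and> word_eval W w = x" v length] v by blast
  then show ?thesis using that[of w] unfolding reduced_word_def by blast
qed

end

section \<open>Galleries in right-angled buildings\<close>

context right_angled_building
begin

abbreviation Ch :: "'c set" where "Ch \<equiv> chambers \<Delta>"

lemma adjacent_sym: "adjacent \<Delta> s c d \<Longrightarrow> adjacent \<Delta> s d c"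
  by (simp add: adjacent_def insert_commute)

lemma adjacentD:
  assumes "adjacent \<Delta> s c d"
  shows "c \<in> Ch" "d \<in> Ch" "c \<noteq> d" "s \<in> S"
proof -
  have "{c, d} \<in> edges \<Delta>" "color \<Delta> {c, d} = s" using assms by (auto simp: adjacent_def)
  then show "c \<in> Ch" "d \<in> Ch" "c \<noteq> d" "s \<in> S"
    using edge_endpoints[of "{c, d}"] edge_color[of "{c, d}"] by auto
qed

lemma adjacent_trans:
  assumes "adjacent \<Delta> s c d" "adjacent \<Delta> s d e" "c \<noteq> e"
  shows "adjacent \<Delta> s c e"
proof -
  let ?P = "{x. (adjacent \<Delta> s)\<^sup>*\<^sup>* c x}"
  have "c \<in> Ch" "s \<in> S" using adjacentD assms(1) by blast+
  then have "?P \<in> panels \<Delta> s" unfolding panels_def by blast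
  moreover have "(adjacent \<Delta> s)\<^sup>*\<^sup>* c e"
    using assms(1,2) by (meson converse_rtranclp_into_rtranclp rtranclp.rtrancl_refl)
  ultimately show ?thesis
    using panel_complete[OF \<open>s \<in> S\<close>, of ?P c e] assms(3) by blast
qed

definition panel :: "'w \<Rightarrow> 'c \<Rightarrow> 'c set" where
  "panel s c = insert c {d. adjacent \<Delta> s c d}"

lemma panel_self: "c \<in> panel s c"
  by (simp add: panel_def)

lemma panel_eq: "d \<in> panel s c \<Longrightarrow> panel s d = panel s c"
  unfolding panel_def using adjacent_trans adjacent_sym by blast

lemma panel_chambers: "c \<in> Ch \<Longrightarrow> d \<in> panel s c \<Longrightarrow> d \<in> Ch"
  by (auto simp: panel_def dest: adjacentD)

lemma panel_in_panels:
  assumes "c \<in> Ch"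
  shows "panel s c \<in> panels \<Delta> s"
proof -
  have "(adjacent \<Delta> s)\<^sup>*\<^sup>* c d \<longleftrightarrow> d \<in> panel s c" for d
  proof
    assume "(adjacent \<Delta> s)\<^sup>*\<^sup>* c d"
    then show "d \<in> panel s c"
      by (induction rule: rtranclp_induct) (auto simp: panel_def intro: adjacent_trans)
  qed (auto simp: panel_def)
  then show ?thesis unfolding panels_def using assms by auto
qed

lemma gallery_append:
  "gallery \<Delta> (u @ v) c e \<longleftrightarrow> (\<exists>d. gallery \<Delta> u c d \<and> gallery \<Delta> v d e)"
  by (induction u arbitrary: c) auto

lemma gallery_types: "gallery \<Delta> w c d \<Longrightarrow> w \<in> lists S"
  by (induction w arbitrary: c) (auto dest: adjacentD)

lemma gallery_chambers: "gallery \<Delta> w c d \<Longrightarrow> c \<in> Ch \<Longrightarrow> d \<in> Ch"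
  by (induction w arbitrary: c) (auto dest: adjacentD)

lemma gallery_rev: "gallery \<Delta> w c d \<Longrightarrow> gallery \<Delta> (rev w) d c"
  by (induction w arbitrary: c) (auto simp: gallery_append intro: adjacent_sym)

lemma gallery_connected:
  assumes "c \<in> Ch" "d \<in> Ch"
  obtains w where "gallery \<Delta> w c d"
proof -
  obtain w where "reduced_word W S w" "word_eval W w = \<delta> c d"
    using carrier_reduced_word[OF weyl_distance_closed[OF assms]] by blast
  then show ?thesis using weyl_distance_gallery[OF assms, of w] that by simp
qed

text \<open>
  Both words are reduced and represent the same element, and galleries of reduced type exist according to the
  Weyl distance alone.
\<close>

lemma gallery_swap:
  assumes st: "commutes s t" and g: "gallery \<Delta> [s, t] c d"
  shows "gallery \<Delta> [t, s] c d"
proof -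
  have S: "s \<in> S" "t \<in> S" "s \<noteq> t" "s \<otimes> t = t \<otimes> s" using st by (auto simp: commutes_def)
  have cd: "c \<in> Ch" "d \<in> Ch" using g by (auto dest: adjacentD)
  have "reduced_word W S [s, t]" "reduced_word W S [t, s]"
    using S by (auto intro!: irreducible_imp_reduced irreducible_pair)
  moreover have "word_eval W [s, t] = word_eval W [t, s]"
    using S subsetD[OF generators_closed] by (simp add: word_eval_def)
  ultimately show ?thesis using weyl_distance_gallery[OF cd] g by metis
qed

lemma gallery_move_front:
  "\<lbrakk>\<forall>t \<in> set b. commutes s t; gallery \<Delta> (b @ [s]) c d\<rbrakk> \<Longrightarrow> gallery \<Delta> (s # b) c d"
proof (induction b arbitrary: c)
  case (Cons t b)
  obtain c1 where c1: "adjacent \<Delta> t c c1" "gallery \<Delta> (b @ [s]) c1 d" using Cons.prems by auto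
  have "gallery \<Delta> (s # b) c1 d" using Cons.IH c1 Cons.prems by simp
  then obtain c2 where c2: "adjacent \<Delta> s c1 c2" "gallery \<Delta> b c2 d" by auto
  have "gallery \<Delta> [t, s] c c2" "commutes t s"
    using c1 c2 Cons.prems by (auto intro: indep_sym)
  then have "gallery \<Delta> [s, t] c c2" using gallery_swap by blast
  then show ?case using c2 by auto
qed simp

text \<open>
  The second \<open>s\<close>-step is moved next to the first one. The two then stay in one panel, so they amount to a single
  step or to none.
\<close>

lemma gallery_shorten:
  assumes "gallery \<Delta> w c d" "\<not> irreducible_word w"
  obtains v where "gallery \<Delta> v c d" "length v < length w" "set v \<subseteq> set w"
proof -
  obtain a s b e where w: "w = a @ s # b @ s # e" and b: "\<forall>t \<in> set b. commutes s t"
    using assms(2) unfolding irreducible_word_def by blast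
  obtain x x' y where x: "gallery \<Delta> a c x" "adjacent \<Delta> s x x'" "gallery \<Delta> (b @ [s]) x' y"
      "gallery \<Delta> e y d"
    using assms(1) unfolding w by (auto simp: gallery_append)
  then obtain x'' where x'': "adjacent \<Delta> s x' x''" "gallery \<Delta> b x'' y"
    using gallery_move_front[OF b x(3)] by auto
  show ?thesis
  proof (cases "x = x''")
    case True
    then have "gallery \<Delta> (a @ b @ e) c d" using x x'' by (auto simp: gallery_append)
    then show ?thesis by (rule that) (auto simp: w)
  next
    case False
    then have "gallery \<Delta> (a @ s # b @ e) c d"
      using x x'' adjacent_trans[OF x(2) x''(1)] by (auto simp: gallery_append)
    then show ?thesis by (rule that) (auto simp: w)
  qed
qed

lemma gallery_irreducible:
  assumes "gallery \<Delta> w c d"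
  obtains v where "gallery \<Delta> v c d" "irreducible_word v" "set v \<subseteq> set w"
proof -
  obtain v where v: "gallery \<Delta> v c d \<and> set v \<subseteq> set w"
    "\<forall>u. gallery \<Delta> u c d \<and> set u \<subseteq> set w \<longrightarrow> length v \<le> length u"
    using ex_has_least_nat[of "\<lambda>v. gallery \<Delta> v c d \<and> set v \<subseteq> set w" w length] assms by blast
  have "irreducible_word v"
  proof (rule ccontr)
    assume "\<not> irreducible_word v"
    then obtain u where "gallery \<Delta> u c d" "length u < length v" "set u \<subseteq> set v"
      using gallery_shorten v(1) by blast
    then show False using v by (meson leD subset_trans)
  qed
  then show ?thesis using that v by blast
qed

text \<open>
  Shortening the gallery of type \<open>w\<close> introduces no new letters and ends in an irreducible, hence reduced,
  word for the Weyl distance. All such words have the same letters.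
\<close>

lemma irreducible_gallery_support:
  assumes "c \<in> Ch" "gallery \<Delta> u c d" "irreducible_word u" "gallery \<Delta> w c d"
  shows "set u \<subseteq> set w"
proof -
  obtain v where v: "gallery \<Delta> v c d" "irreducible_word v" "set v \<subseteq> set w"
    using gallery_irreducible assms(4) by blast
  have d: "d \<in> Ch" using gallery_chambers assms by blast
  have uv: "u \<in> lists S" "v \<in> lists S" using gallery_types assms v by blast+
  have "word_eval W u = \<delta> c d" "word_eval W v = \<delta> c d"
    using weyl_distance_gallery[OF assms(1) d] irreducible_imp_reduced uv assms v by metis+
  then have "set u = set v" using irreducible_words_equal(2)[OF uv assms(3)] v by simp
  then show ?thesis using v by simp
qed

text \<open>Residues of type \<open>{s, t}\<close> with commuting \<open>s\<close> and \<open>t\<close> are grids.\<close>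

lemma panels_grid:
  assumes st: "commutes s t" and a: "a \<in> panel t c" and b: "b \<in> panel s c"
  obtains e where "e \<in> panel s a" "e \<in> panel t b"
proof (cases "a = c \<or> b = c")
  case True
  then show ?thesis using that a b panel_self by blast
next
  case False
  then have "adjacent \<Delta> t c a" "adjacent \<Delta> s b c" using a b by (auto simp: panel_def intro: adjacent_sym)
  then have "gallery \<Delta> [s, t] b a" by auto
  then obtain e where "adjacent \<Delta> t b e" "adjacent \<Delta> s e a" using gallery_swap[OF st] by fastforce
  then show ?thesis using that[of e] by (auto simp: panel_def intro: adjacent_sym)
qed

end

locale thick_semi_regular_building = right_angled_building W S \<Delta> \<delta>
  for W :: "('w, 'm) monoid_scheme" (structure) and S :: "'w set"
    and \<Delta> :: "('c, 'w) edge_colored_graph" and \<delta> :: "'c \<Rightarrow> 'c \<Rightarrow> 'w" +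
  assumes locally_finite: "locally_finite S \<Delta>"
    and thick: "thick S \<Delta>"
    and semi_regular: "semi_regular S \<Delta>"
begin

text \<open>By semi-regularity the chosen chamber does not matter (\<open>panel_card\<close>).\<close>

definition panel_size :: "'w \<Rightarrow> nat" where
  "panel_size s = card (panel s (SOME c. c \<in> Ch))"

lemma panel_finite: "s \<in> S \<Longrightarrow> c \<in> Ch \<Longrightarrow> finite (panel s c)"
  using locally_finite panel_in_panels unfolding locally_finite_def by blast

lemma panel_card:
  assumes "s \<in> S" "c \<in> Ch"
  shows "card (panel s c) = panel_size s"
proof -
  have c: "(SOME c. c \<in> Ch) \<in> Ch" using assms(2) by (rule someI)
  then have "panel s c \<approx> panel s (SOME c. c \<in> Ch)"
    using semi_regular panel_in_panels assms unfolding semi_regular_def by blast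
  then show ?thesis
    unfolding panel_size_def
    using eqpoll_iff_card[OF panel_finite panel_finite] assms c by blast
qed

lemma panel_card_ge3:
  assumes "s \<in> S" "c \<in> Ch"
  shows "card (panel s c) \<ge> 3"
  using thick panel_in_panels panel_finite assms unfolding thick_def by blast

lemma panel_size_pos: "s \<in> S \<Longrightarrow> c \<in> Ch \<Longrightarrow> panel_size s > 0"
  using panel_card_ge3 panel_card by fastforce

section \<open>Colourings of panels and the uniqueness of buildings\<close>

text \<open>
  Two \<open>s\<close>-panels joined by edges of a type commuting with \<open>s\<close> are coloured alike. Other panels are coloured
  independently of each other; this freedom is the source of automorphisms.
\<close>

definition colouring :: "'w \<Rightarrow> ('c \<Rightarrow> nat) \<Rightarrow> bool" where
  "colouring s h \<longleftrightarrow> (\<forall>c \<in> Ch. bij_betw h (panel s c) {..<panel_size s}) \<and>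
     (\<forall>t c d. commutes s t \<longrightarrow> adjacent \<Delta> t c d \<longrightarrow> h c = h d)"

text \<open>Rotation by \<open>k\<close> within each \<open>s\<close>-panel. The inverse image exists because \<open>h\<close> is a bijection from the panel onto
  all residues.\<close>

definition shift :: "'w \<Rightarrow> ('c \<Rightarrow> nat) \<Rightarrow> nat \<Rightarrow> 'c \<Rightarrow> 'c" where
  "shift s h k c = inv_into (panel s c) h ((h c + k) mod panel_size s)"

lemma shift_panel:
  assumes "colouring s h" "s \<in> S" "c \<in> Ch"
  shows "shift s h k c \<in> panel s c" "h (shift s h k c) = (h c + k) mod panel_size s"
    "shift s h k c \<in> Ch"
proof -
  have "bij_betw h (panel s c) {..<panel_size s}" using assms by (simp add: colouring_def)
  then have "(h c + k) mod panel_size s \<in> h ` panel s c"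
    using panel_size_pos[OF assms(2,3)] by (simp add: bij_betw_def)
  then show "shift s h k c \<in> panel s c" "h (shift s h k c) = (h c + k) mod panel_size s"
    unfolding shift_def by (auto intro: inv_into_into f_inv_into_f)
  then show "shift s h k c \<in> Ch" using panel_chambers assms by blast
qed

lemma shift_unique:
  assumes "colouring s h" "s \<in> S" "c \<in> Ch" "d \<in> panel s c"
    "h d = (h c + k) mod panel_size s"
  shows "shift s h k c = d"
proof -
  have "inj_on h (panel s c)" using assms by (simp add: colouring_def bij_betw_def)
  then show ?thesis using shift_panel[OF assms(1-3), of k] assms(4,5) by (metis inj_onD)
qed

lemma colour_less:
  assumes "colouring s h" "c \<in> Ch"
  shows "h c < panel_size s"
  using assms panel_self[of c s] unfolding colouring_def bij_betw_def by blast

lemma shift_stationary: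
  assumes "colouring s h" "s \<in> S" "c \<in> Ch"
  shows "shift s h k c = c \<longleftrightarrow> k mod panel_size s = 0"
proof
  assume "shift s h k c = c"
  then have "(h c + k) mod panel_size s = (h c + 0) mod panel_size s"
    using shift_panel(2)[OF assms, of k] colour_less[OF assms(1,3)] by simp
  then show "k mod panel_size s = 0"
    using mod_eq_dvd_iff_nat[of "h c" "h c + k" "panel_size s"] by auto
next
  assume "k mod panel_size s = 0"
  then show "shift s h k c = c"
    using assms panel_self[of c s] colour_less[OF assms(1,3)] mod_add_right_eq[of "h c" k "panel_size s"]
    by (intro shift_unique) simp_all
qed

lemma shift_shift:
  assumes "colouring s h" "s \<in> S" "c \<in> Ch"
  shows "shift s h l (shift s h k c) = shift s h (k + l) c"
proof -
  let ?d = "shift s h k c"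
  note d = shift_panel[OF assms, of k]
  note e = shift_panel[OF assms(1,2) d(3), of l]
  have "shift s h l ?d \<in> panel s c" using e(1) panel_eq[OF d(1)] by simp
  moreover have "h (shift s h l ?d) = (h c + (k + l)) mod panel_size s"
    unfolding e(2) d(2) by (simp add: mod_add_left_eq add.assoc)
  ultimately show ?thesis using shift_unique[OF assms] by metis
qed

text \<open>
  Going from \<open>c\<close> to the two rotated chambers spans a grid. Its fourth corner has the \<open>s\<close>-colour of one neighbour
  and the \<open>t\<close>-colour of the other, so it is the result of the rotations in both orders.
\<close>

lemma shift_commute:
  assumes "colouring s h" "colouring t g" "commutes s t" "c \<in> Ch"
  shows "shift s h k (shift t g l c) = shift t g l (shift s h k c)"
proof -
  have S: "s \<in> S" "t \<in> S" "commutes t s" using assms(3) by (auto simp: commutes_def)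
  let ?a = "shift t g l c" and ?b = "shift s h k c"
  note a = shift_panel[OF assms(2) S(2) assms(4), of l]
  note b = shift_panel[OF assms(1) S(1) assms(4), of k]
  obtain e where e: "e \<in> panel s ?a" "e \<in> panel t ?b" using panels_grid[OF assms(3) a(1) b(1)] by blast
  have s: "h x = h y" if "x \<in> panel t y" for x y
    using that assms(1,3) by (auto simp: colouring_def panel_def)
  have t: "g x = g y" if "x \<in> panel s y" for x y
    using that assms(2) S(3) by (auto simp: colouring_def panel_def)
  have "shift s h k ?a = e"
    using e s[OF e(2)] s[OF a(1)] b(2) by (intro shift_unique assms S a) simp_all
  moreover have "shift t g l ?b = e"
    using e t[OF e(1)] t[OF b(1)] a(2) by (intro shift_unique assms S b) simp_all
  ultimately show ?thesis by simp
qed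

lemma shift_reaches:
  assumes "colouring s h" "s \<in> S" "c \<in> Ch" "d \<in> panel s c"
  obtains k where "shift s h k c = d"
proof -
  have d: "d \<in> Ch" using panel_chambers assms by blast
  \<comment> \<open>The rotation by the difference of the colours; adding the panel size avoids negative numbers.\<close>
  have "(h c + (h d + (panel_size s - h c))) mod panel_size s = h d"
    using colour_less[OF assms(1,3)] colour_less[OF assms(1) d] by simp
  then show ?thesis using shift_unique[OF assms] that by metis
qed

definition colour_system :: "('w \<Rightarrow> 'c \<Rightarrow> nat) \<Rightarrow> bool" where
  "colour_system h \<longleftrightarrow> (\<forall>s \<in> S. colouring s (h s))"

text \<open>The letter \<open>(s, k)\<close> stands for the rotation of \<open>s\<close>-panels by \<open>k\<close>.\<close>

definition walk :: "('w \<Rightarrow> 'c \<Rightarrow> nat) \<Rightarrow> ('w \<times> nat) list \<Rightarrow> 'c \<Rightarrow> 'c" where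
  "walk h w = fold (\<lambda>(s, k). shift s (h s) k) w"

lemma walk_simps [simp]:
  "walk h [] c = c"
  "walk h ((s, k) # w) c = walk h w (shift s (h s) k c)"
  by (simp_all add: walk_def)

lemma walk_append: "walk h (u @ v) c = walk h v (walk h u c)"
  by (simp add: walk_def)

lemma walk_chambers:
  assumes "colour_system h"
  shows "\<lbrakk>fst ` set w \<subseteq> S; c \<in> Ch\<rbrakk> \<Longrightarrow> walk h w c \<in> Ch"
proof (induction w arbitrary: c)
  case (Cons x w)
  obtain s k where x: "x = (s, k)" by fastforce
  then show ?case
    using Cons shift_panel(3)[of s "h s" c k] assms by (simp add: colour_system_def)
qed simp

lemma walk_gallery:
  assumes "colour_system h"
  shows "\<lbrakk>fst ` set w \<subseteq> S; c \<in> Ch; \<forall>(s, k) \<in> set w. k mod panel_size s \<noteq> 0\<rbrakk>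
    \<Longrightarrow> gallery \<Delta> (map fst w) c (walk h w c)"
proof (induction w arbitrary: c)
  case (Cons x w)
  obtain s k where x: "x = (s, k)" by fastforce
  have s: "s \<in> S" "colouring s (h s)" using Cons.prems assms x by (auto simp: colour_system_def)
  let ?d = "shift s (h s) k c"
  note d = shift_panel[OF s(2,1) Cons.prems(2), of k]
  have "?d \<noteq> c" using shift_stationary[OF s(2,1) Cons.prems(2)] Cons.prems(3) x by auto
  then have "adjacent \<Delta> s c ?d" using d(1) by (auto simp: panel_def)
  moreover have "gallery \<Delta> (map fst w) ?d (walk h w ?d)" using Cons d(3) by simp
  ultimately show ?case using x by auto
qed simp

lemma walk_move_front:
  assumes "colour_system h"
  shows "\<lbrakk>\<forall>t \<in> fst ` set b. commutes s t; c \<in> Ch\<rbrakk>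
    \<Longrightarrow> walk h (b @ [(s, k)]) c = walk h ((s, k) # b) c"
proof (induction b arbitrary: c)
  case (Cons x b)
  obtain t l where x: "x = (t, l)" by fastforce
  have st: "commutes s t" "s \<in> S" "t \<in> S" using Cons.prems x by (auto simp: commutes_def)
  then have col: "colouring s (h s)" "colouring t (h t)" using assms by (auto simp: colour_system_def)
  have "shift t (h t) l c \<in> Ch" using shift_panel(3) col st Cons.prems by blast
  then show ?case
    using Cons x shift_commute[OF col st(1) Cons.prems(2), of k l] by simp
qed simp

lemma walk_merge:
  assumes "colour_system h" "fst ` set (a @ (s, k) # b @ (s, l) # e) \<subseteq> S"
    "\<forall>t \<in> fst ` set b. commutes s t" "c \<in> Ch"
  shows "walk h (a @ (s, k) # b @ (s, l) # e) c = walk h (a @ (s, k + l) # b @ e) c"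
proof -
  have s: "s \<in> S" "colouring s (h s)" using assms by (auto simp: colour_system_def)
  let ?c = "walk h a c"
  have c: "?c \<in> Ch" using assms by (intro walk_chambers) auto
  let ?d = "shift s (h s) k ?c"
  have d: "?d \<in> Ch" using shift_panel(3) s c by blast
  have "walk h (a @ (s, k) # b @ (s, l) # e) c = walk h e (walk h (b @ [(s, l)]) ?d)"
    by (simp add: walk_append)
  also have "\<dots> = walk h e (walk h b (shift s (h s) l ?d))"
    using walk_move_front[OF assms(1,3) d] by simp
  also have "\<dots> = walk h (a @ (s, k + l) # b @ e) c"
    using shift_shift[OF s(2,1) c] by (simp add: walk_append)
  finally show ?thesis .
qed

text \<open>
  Whether a walk is closed can be read off its word. Letters that rotate by 0 are dropped, and two letters of the
  same type are merged if all types between them commute with theirs; neither operation depends on the colouring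
  or the starting chamber. If nothing can be dropped or merged, the walk is a gallery
  of reduced type, and this is closed only if it is empty.
\<close>

lemma closed_walk_transfer:
  assumes h: "colour_system h" and g: "colour_system g" and c: "c \<in> Ch" and d: "d \<in> Ch"
  shows "\<lbrakk>fst ` set w \<subseteq> S; walk h w c = c\<rbrakk> \<Longrightarrow> walk g w d = d"
proof (induction w rule: length_induct)
  case (1 w)
  have IH: "walk g w d = d"
    if v: "length v < length w" "fst ` set v \<subseteq> S"
      "\<And>h c. colour_system h \<Longrightarrow> c \<in> Ch \<Longrightarrow> walk h w c = walk h v c" for v
    using 1 v(1,2) v(3)[OF h c] v(3)[OF g d] by simp
  \<comment> \<open>The first two cases shorten the word; the third is the base case.\<close>
  consider (stationary) "\<exists>(s, k) \<in> set w. k mod panel_size s = 0"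
    | (reducible) "\<not> irreducible_word (map fst w)"
    | (irreducible) "\<forall>(s, k) \<in> set w. k mod panel_size s \<noteq> 0" "irreducible_word (map fst w)"
    by blast
  then show ?case
  proof cases
    case stationary
    then obtain a s k e where w: "w = a @ (s, k) # e" and k: "k mod panel_size s = 0"
      by (auto simp: in_set_conv_decomp)
    show ?thesis
    proof (rule IH[of "a @ e"])
      fix h c assume hc: "colour_system h" "c \<in> Ch"
      have "s \<in> S" "walk h a c \<in> Ch" using hc 1(2) w by (auto intro!: walk_chambers)
      then show "walk h w c = walk h (a @ e) c"
        using hc k shift_stationary[of s "h s" "walk h a c" k]
        by (simp add: w walk_append colour_system_def)
    qed (use 1(2) w in auto)
  next
    case reducible
    then obtain a' s b' e' where eq: "map fst w = a' @ s # b' @ s # e'"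
      and b': "\<forall>t \<in> set b'. commutes s t"
      unfolding irreducible_word_def by blast
    then obtain a k b l e where w: "w = a @ (s, k) # b @ (s, l) # e" and b: "map fst b = b'"
      by (auto simp: map_eq_append_conv map_eq_Cons_conv append_eq_map_conv Cons_eq_map_conv)
    have b'': "\<forall>t \<in> fst ` set b. commutes s t" using b' unfolding b[symmetric] set_map .
    show ?thesis
    proof (rule IH[of "a @ (s, k + l) # b @ e"])
      fix h c assume "colour_system h" "c \<in> Ch"
      then show "walk h w c = walk h (a @ (s, k + l) # b @ e) c"
        unfolding w using 1(2) b'' by (intro walk_merge) (auto simp: w)
    qed (use 1(2) w in auto)
  next
    case irreducible
    have "gallery \<Delta> (map fst w) c c" using walk_gallery[OF h 1(2) c] irreducible 1(3) by simp
    then have "set (map fst w) \<subseteq> set []"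
      using irreducible_gallery_support[OF c _ irreducible(2), of c "[]"] by simp
    then show ?thesis by simp
  qed
qed

text \<open>Rotations are by natural numbers, so the inverse of the rotation by \<open>k\<close> is the rotation by the complement of
  \<open>k\<close> modulo the panel size.\<close>

definition inverse_word :: "('w \<times> nat) list \<Rightarrow> ('w \<times> nat) list" where
  "inverse_word w = rev (map (\<lambda>(s, k). (s, panel_size s - k mod panel_size s)) w)"

lemma inverse_word_types: "fst ` set (inverse_word w) = fst ` set w"
  by (force simp: inverse_word_def)

lemma shift_inverse:
  assumes "colouring s h" "s \<in> S" "c \<in> Ch"
  shows "shift s h (panel_size s - k mod panel_size s) (shift s h k c) = c"
    "shift s h k (shift s h (panel_size s - k mod panel_size s) c) = c"
proof -
  let ?q = "panel_size s"
  have "(k + (?q - k mod ?q)) mod ?q = (k mod ?q + (?q - k mod ?q)) mod ?q"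
    by (simp add: mod_add_left_eq)
  also have "\<dots> = 0" using panel_size_pos[OF assms(2,3)] by simp
  finally show "shift s h (?q - k mod ?q) (shift s h k c) = c"
    "shift s h k (shift s h (?q - k mod ?q) c) = c"
    using shift_shift[OF assms] shift_stationary[OF assms] by (simp_all add: add.commute)
qed

lemma walk_inverse:
  assumes "colour_system h"
  shows "\<lbrakk>fst ` set w \<subseteq> S; c \<in> Ch\<rbrakk> \<Longrightarrow> walk h (inverse_word w) (walk h w c) = c"
    "\<lbrakk>fst ` set w \<subseteq> S; c \<in> Ch\<rbrakk> \<Longrightarrow> walk h w (walk h (inverse_word w) c) = c"
proof -
  show "walk h (inverse_word w) (walk h w c) = c" if "fst ` set w \<subseteq> S" "c \<in> Ch" for c
    using that
  proof (induction w arbitrary: c)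
    case (Cons x w)
    obtain s k where x: "x = (s, k)" by fastforce
    have s: "colouring s (h s)" "s \<in> S" using Cons.prems assms x by (auto simp: colour_system_def)
    show ?case
      using Cons x shift_panel(3)[OF s Cons.prems(2)] shift_inverse(1)[OF s Cons.prems(2)]
      by (simp add: inverse_word_def walk_append)
  qed (simp add: inverse_word_def)
  show "walk h w (walk h (inverse_word w) c) = c" if "fst ` set w \<subseteq> S" "c \<in> Ch" for c
    using that
  proof (induction w arbitrary: c rule: rev_induct)
    case (snoc x w)
    obtain s k where x: "x = (s, k)" by fastforce
    have s: "colouring s (h s)" "s \<in> S" using snoc.prems assms x by (auto simp: colour_system_def)
    show ?case
      using snoc x shift_panel(3)[OF s snoc.prems(2)] shift_inverse(2)[OF s snoc.prems(2)]
      by (simp add: inverse_word_def walk_append)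
  qed (simp add: inverse_word_def)
qed

lemma walk_transfer:
  assumes h: "colour_system h" and g: "colour_system g" and c: "c \<in> Ch" and d: "d \<in> Ch"
    and u: "fst ` set u \<subseteq> S" and v: "fst ` set v \<subseteq> S" and eq: "walk h u c = walk h v c"
  shows "walk g u d = walk g v d"
proof -
  have "walk h (u @ inverse_word v) c = c"
    using walk_inverse(1)[OF h v c] eq by (simp add: walk_append)
  moreover have "fst ` set (u @ inverse_word v) \<subseteq> S" using u v inverse_word_types by (simp add: image_Un)
  ultimately have "walk g (inverse_word v) (walk g u d) = d"
    using closed_walk_transfer[OF h g c d, of "u @ inverse_word v"] by (simp add: walk_append)
  then show ?thesis using walk_inverse(2)[OF g v, of "walk g u d"] walk_chambers[OF g u d] by simp
qed

lemma walk_reaches: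
  assumes h: "colour_system h" and c: "c \<in> Ch" and d: "d \<in> Ch"
  obtains w where "fst ` set w \<subseteq> S" "walk h w c = d"
proof -
  obtain u where "gallery \<Delta> u c d" using gallery_connected c d by blast
  then have "\<exists>w. fst ` set w \<subseteq> S \<and> walk h w c = d"
  proof (induction u arbitrary: c)
    case Nil
    then show ?case by (intro exI[of _ "[]"]) simp
  next
    case (Cons s u)
    then obtain c' where c': "adjacent \<Delta> s c c'" "gallery \<Delta> u c' d" by auto
    have "s \<in> S" "c \<in> Ch" "c' \<in> panel s c" using adjacentD c' by (auto simp: panel_def)
    then obtain k where k: "shift s (h s) k c = c'"
      using shift_reaches h by (metis colour_system_def)
    obtain w where "fst ` set w \<subseteq> S" "walk h w c' = d" using Cons.IH c' by blast
    then show ?case using k \<open>s \<in> S\<close> by (intro exI[of _ "(s, k) # w"]) simp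
  qed
  then show ?thesis using that by blast
qed

text \<open>
  A chamber reached from \<open>c\<close> by a word of rotations with respect to \<open>h\<close> is sent to the one reached from \<open>d\<close>
  by the same word with respect to \<open>g\<close>. By \<open>walk_transfer\<close> the choice of the word does not matter.
\<close>

definition transport :: "('w \<Rightarrow> 'c \<Rightarrow> nat) \<Rightarrow> 'c \<Rightarrow> ('w \<Rightarrow> 'c \<Rightarrow> nat) \<Rightarrow> 'c \<Rightarrow> 'c \<Rightarrow> 'c" where
  "transport h c g d = (\<lambda>x \<in> Ch. walk g (SOME w. fst ` set w \<subseteq> S \<and> walk h w c = x) d)"

lemma transport_walk:
  assumes "colour_system h" "colour_system g" "c \<in> Ch" "d \<in> Ch" "fst ` set w \<subseteq> S"
  shows "transport h c g d (walk h w c) = walk g w d"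
proof -
  let ?v = "SOME v. fst ` set v \<subseteq> S \<and> walk h v c = walk h w c"
  have v: "fst ` set ?v \<subseteq> S \<and> walk h ?v c = walk h w c"
    by (rule someI[of _ w]) (use assms in simp)
  then have "walk g ?v d = walk g w d" using walk_transfer assms by blast
  then show ?thesis using walk_chambers assms by (simp add: transport_def)
qed

lemma transport_base:
  assumes "colour_system h" "colour_system g" "c \<in> Ch" "d \<in> Ch"
  shows "transport h c g d c = d"
  using transport_walk[OF assms, of "[]"] by simp

lemma transport_shift:
  assumes hg: "colour_system h" "colour_system g" and cd: "c \<in> Ch" "d \<in> Ch"
    and s: "s \<in> S" and x: "x \<in> Ch"
  shows "transport h c g d (shift s (h s) k x) = shift s (g s) k (transport h c g d x)"
proof -
  obtain w where w: "fst ` set w \<subseteq> S" "walk h w c = x" using walk_reaches[OF hg(1) cd(1) x] by blast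
  then have "transport h c g d (walk h (w @ [(s, k)]) c) = walk g (w @ [(s, k)]) d"
    using s by (intro transport_walk hg cd) auto
  then show ?thesis using w transport_walk[OF hg cd w(1)] by (simp add: walk_append)
qed

lemma transport_inverse:
  assumes hg: "colour_system h" "colour_system g" and cd: "c \<in> Ch" "d \<in> Ch" and x: "x \<in> Ch"
  shows "transport h c g d x \<in> Ch" "transport g d h c (transport h c g d x) = x"
proof -
  obtain w where w: "fst ` set w \<subseteq> S" "walk h w c = x" using walk_reaches[OF hg(1) cd(1) x] by blast
  show "transport h c g d x \<in> Ch"
    using transport_walk[OF hg cd w(1)] walk_chambers[OF hg(2) w(1) cd(2)] w by simp
  show "transport g d h c (transport h c g d x) = x"
    using transport_walk[OF hg cd w(1)] transport_walk[OF hg(2,1) cd(2,1) w(1)] w by simp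
qed

lemma transport_adjacent:
  assumes hg: "colour_system h" "colour_system g" and cd: "c \<in> Ch" "d \<in> Ch"
    and a: "adjacent \<Delta> s x y"
  shows "adjacent \<Delta> s (transport h c g d x) (transport h c g d y)"
proof -
  let ?f = "transport h c g d"
  have xy: "x \<in> Ch" "y \<in> Ch" "x \<noteq> y" "s \<in> S" using adjacentD[OF a] by blast+
  then have "colouring s (h s)" "colouring s (g s)" using hg by (auto simp: colour_system_def)
  moreover have "y \<in> panel s x" using a by (simp add: panel_def)
  ultimately obtain k where k: "shift s (h s) k x = y" using shift_reaches xy by metis
  have "?f y \<in> panel s (?f x)"
    using transport_shift[OF hg cd xy(4,1), of k] k
      shift_panel(1)[OF \<open>colouring s (g s)\<close> xy(4) transport_inverse(1)[OF hg cd xy(1)], of k] by simp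
  moreover have "?f x \<noteq> ?f y"
    using transport_inverse(2)[OF hg cd] xy by metis
  ultimately show ?thesis by (auto simp: panel_def)
qed

lemma transport_Aut:
  assumes hg: "colour_system h" "colour_system g" and cd: "c \<in> Ch" "d \<in> Ch"
  shows "transport h c g d \<in> carrier (Aut \<Delta>)"
  unfolding Aut_carrier
proof (intro conjI allI ballI)
  let ?f = "transport h c g d" and ?f' = "transport g d h c"
  have "bij_betw ?f Ch Ch"
    by (rule bij_betw_byWitness[of _ ?f'])
      (use transport_inverse[OF hg cd] transport_inverse[OF hg(2,1) cd(2,1)] in auto)
  then show "?f \<in> Bij Ch" by (simp add: Bij_def transport_def)
  fix s x y assume xy: "x \<in> Ch" "y \<in> Ch"
  show "adjacent \<Delta> s (?f x) (?f y) \<longleftrightarrow> adjacent \<Delta> s x y"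
    using transport_adjacent[OF hg cd, of s x y] transport_adjacent[OF hg(2,1) cd(2,1), of s "?f x" "?f y"]
      transport_inverse(2)[OF hg cd] xy by auto
qed

end

section \<open>Walls and wings\<close>

context right_angled_building
begin

definition reach :: "'w set \<Rightarrow> 'c \<Rightarrow> 'c \<Rightarrow> bool" where
  "reach J c d \<longleftrightarrow> (\<exists>w \<in> lists J. gallery \<Delta> w c d)"

lemma reach_refl: "reach J c c"
  unfolding reach_def by (intro bexI[of _ "[]"]) auto

lemma reach_adjacent: "s \<in> J \<Longrightarrow> adjacent \<Delta> s c d \<Longrightarrow> reach J c d"
  unfolding reach_def by (intro bexI[of _ "[s]"]) auto

lemma reach_panel: "s \<in> J \<Longrightarrow> d \<in> panel s c \<Longrightarrow> reach J c d"
  unfolding panel_def using reach_refl reach_adjacent by blast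

lemma reach_sym: "reach J c d \<Longrightarrow> reach J d c"
  unfolding reach_def
proof (elim bexE)
  fix w assume "w \<in> lists J" "gallery \<Delta> w c d"
  then have "rev w \<in> lists J" "gallery \<Delta> (rev w) d c" using gallery_rev by auto
  then show "\<exists>w \<in> lists J. gallery \<Delta> w d c" by blast
qed

lemma reach_trans: "reach J c d \<Longrightarrow> reach J d e \<Longrightarrow> reach J c e"
  unfolding reach_def
proof (elim bexE)
  fix u v assume "u \<in> lists J" "v \<in> lists J" "gallery \<Delta> u c d" "gallery \<Delta> v d e"
  then have "u @ v \<in> lists J" "gallery \<Delta> (u @ v) c e" by (auto simp: gallery_append)
  then show "\<exists>w \<in> lists J. gallery \<Delta> w c e" by blast
qed

lemma reach_chambers: "reach J c d \<Longrightarrow> c \<in> Ch \<Longrightarrow> d \<in> Ch"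
  unfolding reach_def using gallery_chambers by blast

text \<open>Chambers of a wall that lie in the same wing.\<close>

abbreviation parallel :: "'w \<Rightarrow> 'c \<Rightarrow> 'c \<Rightarrow> bool" where
  "parallel s \<equiv> reach {t. commutes s t}"

text \<open>
  The residue of \<open>c\<close> whose types are \<open>s\<close> and the generators commuting with \<open>s\<close>, called a tree-wall in the
  literature. It is the union of the \<open>s\<close>-panels parallel to that of \<open>c\<close>.
\<close>

definition wall :: "'w \<Rightarrow> 'c \<Rightarrow> 'c set" where
  "wall s c = {d. reach (insert s {t. commutes s t}) c d}"

lemma wall_self: "c \<in> wall s c"
  by (simp add: wall_def reach_refl)

lemma wall_eq: "d \<in> wall s c \<Longrightarrow> wall s d = wall s c"
  unfolding wall_def using reach_sym reach_trans by blast

lemma wall_mem_cong: "d \<in> wall s c \<Longrightarrow> d \<in> wall s x \<longleftrightarrow> c \<in> wall s x"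
  unfolding wall_def using reach_sym reach_trans by blast

lemma panel_subset_wall: "d \<in> panel s c \<Longrightarrow> d \<in> wall s c"
  unfolding wall_def using reach_panel by blast

lemma commuting_adjacent_wall: "commutes s t \<Longrightarrow> adjacent \<Delta> t c d \<Longrightarrow> d \<in> wall s c"
  unfolding wall_def using reach_adjacent by blast

text \<open>
  Otherwise the letter \<open>s\<close> would be a reduced type for two chambers that are also joined by a gallery without the
  letter \<open>s\<close>.
\<close>

lemma parallel_in_panel:
  assumes "s \<in> S" "c \<in> Ch" "d \<in> panel s c" "parallel s c d"
  shows "d = c"
proof (rule ccontr)
  assume "d \<noteq> c"
  then have g: "gallery \<Delta> [s] c d" using assms(3) by (simp add: panel_def)
  obtain w where w: "w \<in> lists {t. commutes s t}" "gallery \<Delta> w c d"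
    using assms(4) unfolding reach_def by blast
  have "set [s] \<subseteq> set w"
    using irreducible_gallery_support[OF assms(2) g irreducible_singleton w(2)] .
  then show False using w(1) indep_irrefl by auto
qed

lemma parallel_lift:
  assumes "parallel s c d" "c' \<in> panel s c"
  obtains d' where "d' \<in> panel s d" "parallel s c' d'"
proof -
  obtain w where "w \<in> lists {t. commutes s t}" "gallery \<Delta> w c d"
    using assms(1) unfolding reach_def by blast
  then have "\<exists>d' \<in> panel s d. parallel s c' d'"
    using assms(2)
  proof (induction w arbitrary: c c')
    case Nil
    then show ?case using reach_refl by auto
  next
    case (Cons t w)
    then obtain e where e: "adjacent \<Delta> t c e" "gallery \<Delta> w e d" and st: "commutes s t" by auto
    then have "e \<in> panel t c" by (simp add: panel_def)
    then obtain e' where e': "e' \<in> panel s e" "e' \<in> panel t c'"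
      using panels_grid[OF st _ Cons.prems(2)] by blast
    obtain d' where d': "d' \<in> panel s d" "parallel s e' d'"
      using Cons.IH[OF e(2) e'(1)] by blast
    have "parallel s c' e'" using e'(2) st by (intro reach_panel[of t]) auto
    then show ?case using d' reach_trans by blast
  qed
  then show ?thesis using that by blast
qed

lemma wall_projection:
  assumes "d \<in> wall s c"
  obtains c' where "c' \<in> panel s c" "parallel s c' d"
proof -
  obtain w where "w \<in> lists (insert s {t. commutes s t})" "gallery \<Delta> w c d"
    using assms unfolding wall_def reach_def by blast
  then have "\<exists>c' \<in> panel s c. parallel s c' d"
  proof (induction w arbitrary: c)
    case Nil
    then show ?case using reach_refl[of _ d] panel_self[of d s] by auto
  next
    case (Cons t w)
    then obtain e where e: "adjacent \<Delta> t c e" "gallery \<Delta> w e d" by auto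
    obtain e' where e': "e' \<in> panel s e" "parallel s e' d" using Cons.IH[OF e(2)] by blast
    show ?case
    proof (cases "t = s")
      case True
      then have "e \<in> panel s c" using e by (simp add: panel_def)
      then show ?thesis using e' panel_eq by blast
    next
      case False
      then have "commutes s t" using Cons.hyps(1) by simp
      then have "parallel s e c" using e(1) by (intro reach_sym[OF reach_adjacent[of t]]) auto
      then obtain c' where "c' \<in> panel s c" "parallel s e' c'" using parallel_lift e'(1) by blast
      then show ?thesis using e'(2) reach_sym reach_trans by blast
    qed
  qed
  then show ?thesis using that by blast
qed

text \<open>The choice is unique (\<open>projection_unique\<close>): this is the gate of \<open>d\<close> in the \<open>s\<close>-panel of \<open>c\<close>.\<close>

definition projection :: "'w \<Rightarrow> 'c \<Rightarrow> 'c \<Rightarrow> 'c" where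
  "projection s c d = (SOME c'. c' \<in> panel s c \<and> parallel s c' d)"

lemma projection:
  assumes "d \<in> wall s c"
  shows "projection s c d \<in> panel s c" "parallel s (projection s c d) d"
proof -
  have "projection s c d \<in> panel s c \<and> parallel s (projection s c d) d"
    unfolding projection_def by (rule someI_ex) (use wall_projection[OF assms] in blast)
  then show "projection s c d \<in> panel s c" "parallel s (projection s c d) d" by blast+
qed

lemma projection_unique:
  assumes "s \<in> S" "c \<in> Ch" "d \<in> wall s c" "c' \<in> panel s c" "parallel s c' d"
  shows "projection s c d = c'"
proof -
  note p = projection[OF assms(3)]
  have "c' \<in> Ch" using panel_chambers assms by blast
  moreover have "projection s c d \<in> panel s c'" using p(1) panel_eq[OF assms(4)] by simp
  moreover have "parallel s c' (projection s c d)" using p(2) assms(5) reach_sym reach_trans by blast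
  ultimately show ?thesis using parallel_in_panel assms(1) by blast
qed

lemma projection_bij:
  assumes s: "s \<in> S" and c: "c \<in> Ch" and d: "d \<in> wall s c"
  shows "bij_betw (projection s c) (panel s d) (panel s c)"
proof -
  have dC: "d \<in> Ch" using d c reach_chambers unfolding wall_def by blast
  have wall: "x \<in> wall s c" if "x \<in> panel s d" for x
    using panel_subset_wall[OF that] wall_eq[OF d] by simp
  show ?thesis
    unfolding bij_betw_def
  proof (intro conjI inj_onI equalityI subsetI)
    fix x y assume xy: "x \<in> panel s d" "y \<in> panel s d" "projection s c x = projection s c y"
    then have "parallel s x y"
      using projection(2)[OF wall[OF xy(1)]] projection(2)[OF wall[OF xy(2)]] reach_sym reach_trans
      by metis
    moreover have "x \<in> Ch" "y \<in> panel s x" using xy panel_chambers dC panel_eq by blast+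
    ultimately show "x = y" using parallel_in_panel[OF s] by metis
  next
    fix x assume "x \<in> projection s c ` panel s d"
    then show "x \<in> panel s c" using projection(1) wall by blast
  next
    fix x assume x: "x \<in> panel s c"
    have "c \<in> wall s d" using wall_eq[OF d] wall_self by simp
    then obtain d' where d': "d' \<in> panel s d" "parallel s d' c" using wall_projection by blast
    then obtain y where y: "y \<in> panel s d'" "parallel s x y"
      using parallel_lift[OF reach_sym[OF d'(2)] x] by blast
    then have "y \<in> panel s d" using panel_eq[OF d'(1)] by simp
    moreover have "projection s c y = x" using projection_unique[OF s c wall x y(2)] calculation by blast
    ultimately show "x \<in> projection s c ` panel s d" by blast
  qed
qed

text \<open>
  For a wall \<open>T\<close> of type \<open>s\<close> this says that \<open>c\<close> and \<open>d\<close> lie in the same wing: they are joined by a gallery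
  without \<open>s\<close>-edges of \<open>T\<close>.
\<close>

definition avoids :: "'w \<Rightarrow> 'c set \<Rightarrow> 'c \<Rightarrow> 'c \<Rightarrow> bool" where
  "avoids s T = (\<lambda>c d. \<exists>t. adjacent \<Delta> t c d \<and> \<not> (t = s \<and> c \<in> T))\<^sup>*\<^sup>*"

end

section \<open>Automorphisms that fix a wing\<close>

context thick_semi_regular_building
begin

text \<open>The choice depends on the wall only, so that all its panels get their colours from the same panel.\<close>

definition base_chamber :: "'w \<Rightarrow> 'c \<Rightarrow> 'c" where
  "base_chamber s c = (SOME b. b \<in> wall s c)"

text \<open>One panel of the wall is coloured arbitrarily and the colours are carried to the others by projection.\<close>

definition wall_colouring :: "'w \<Rightarrow> 'c \<Rightarrow> nat" where
  "wall_colouring s c = (let b = base_chamber s c in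
     (SOME e. bij_betw e (panel s b) {..<panel_size s}) (projection s b c))"

lemma base_chamber:
  assumes "c \<in> Ch"
  shows "base_chamber s c \<in> Ch" "c \<in> wall s (base_chamber s c)"
    "d \<in> wall s c \<Longrightarrow> base_chamber s d = base_chamber s c"
proof -
  have b: "base_chamber s c \<in> wall s c" unfolding base_chamber_def by (rule someI, rule wall_self)
  then show "base_chamber s c \<in> Ch" using assms reach_chambers unfolding wall_def by blast
  show "c \<in> wall s (base_chamber s c)" using wall_eq[OF b] wall_self by simp
  show "base_chamber s d = base_chamber s c" if "d \<in> wall s c"
    unfolding base_chamber_def using wall_eq[OF that] by simp
qed

lemma colouring_wall_colouring:
  assumes s: "s \<in> S"
  shows "colouring s (wall_colouring s)"
  unfolding colouring_def
proof (intro conjI ballI allI impI)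
  fix c assume c: "c \<in> Ch"
  define b where "b = base_chamber s c"
  define e where "e = (SOME e. bij_betw e (panel s b) {..<panel_size s})"
  have b: "b \<in> Ch" "c \<in> wall s b" using base_chamber c by (simp_all add: b_def)
  have "\<exists>e. bij_betw e (panel s b) {..<panel_size s}"
    using ex_bij_betw_finite_nat[OF panel_finite[OF s b(1)]] panel_card[OF s b(1)]
    by (simp add: lessThan_atLeast0)
  then have "bij_betw e (panel s b) {..<panel_size s}" unfolding e_def by (rule someI_ex)
  then have "bij_betw (e \<circ> projection s b) (panel s c) {..<panel_size s}"
    using bij_betw_trans[OF projection_bij[OF s b]] by blast
  moreover have "wall_colouring s d = (e \<circ> projection s b) d" if "d \<in> panel s c" for d
    using base_chamber(3)[OF c panel_subset_wall[OF that]]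
    by (simp add: wall_colouring_def Let_def b_def e_def)
  ultimately show "bij_betw (wall_colouring s) (panel s c) {..<panel_size s}"
    using bij_betw_cong by blast
next
  fix t c d assume st: "commutes s t" and a: "adjacent \<Delta> t c d"
  have c: "c \<in> Ch" using adjacentD a by blast
  define b where "b = base_chamber s c"
  have b: "b \<in> Ch" "c \<in> wall s b" using base_chamber c by (simp_all add: b_def)
  have d: "d \<in> wall s c" using commuting_adjacent_wall st a by blast
  then have db: "d \<in> wall s b" using wall_eq[OF b(2)] by simp
  have "parallel s c d" using st a by (intro reach_adjacent[of t]) auto
  then have "parallel s (projection s b c) d" using projection(2)[OF b(2)] reach_trans by blast
  then have "projection s b d = projection s b c"
    using projection_unique[OF s b(1) db] projection(1)[OF b(2)] by blast
  then show "wall_colouring s c = wall_colouring s d"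
    using base_chamber(3)[OF c d] by (simp add: wall_colouring_def Let_def b_def)
qed

text \<open>A colouring may be permuted on one wall at a time, since no colour of an \<open>s\<close>-panel outside is tied to it.\<close>

lemma colouring_recolour:
  assumes h: "colouring s h" and p: "bij_betw p {..<panel_size s} {..<panel_size s}"
  shows "colouring s (\<lambda>c. if c \<in> wall s x then p (h c) else h c)" (is "colouring s ?g")
  unfolding colouring_def
proof (intro conjI ballI allI impI)
  fix c assume c: "c \<in> Ch"
  have hc: "bij_betw h (panel s c) {..<panel_size s}" using h c by (simp add: colouring_def)
  have iff: "d \<in> wall s x \<longleftrightarrow> c \<in> wall s x" if "d \<in> panel s c" for d
    using wall_mem_cong[OF panel_subset_wall[OF that]] .
  show "bij_betw ?g (panel s c) {..<panel_size s}"
  proof (cases "c \<in> wall s x")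
    case True
    then have eq: "?g d = (p \<circ> h) d" if "d \<in> panel s c" for d using iff[OF that] by simp
    have "bij_betw ?g (panel s c) A \<longleftrightarrow> bij_betw (p \<circ> h) (panel s c) A" for A
      by (rule bij_betw_cong) (rule eq)
    then show ?thesis using bij_betw_trans[OF hc p] by simp
  next
    case False
    then have eq: "?g d = h d" if "d \<in> panel s c" for d using iff[OF that] by simp
    have "bij_betw ?g (panel s c) A \<longleftrightarrow> bij_betw h (panel s c) A" for A
      by (rule bij_betw_cong) (rule eq)
    then show ?thesis using hc by simp
  qed
next
  fix t c d assume st: "commutes s t" and a: "adjacent \<Delta> t c d"
  have "d \<in> wall s x \<longleftrightarrow> c \<in> wall s x"
    using wall_mem_cong[OF commuting_adjacent_wall[OF st a]] .
  moreover have "h c = h d" using h st a by (simp add: colouring_def)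
  ultimately show "?g c = ?g d" by simp
qed

text \<open>
  The two colour systems differ on \<open>s\<close>-panels of the wall of \<open>x\<close> only, so the automorphism that
  intertwines them and fixes \<open>x\<close> fixes every chamber that is reached from \<open>x\<close> without moving in these panels.
  In the panel of \<open>x\<close> the colours of \<open>y\<close> and \<open>z\<close> are exchanged while that of \<open>x\<close> is kept, so \<open>y\<close> moves to \<open>z\<close>.
\<close>

lemma wing_automorphism:
  assumes s: "s \<in> S" and x: "x \<in> Ch" and y: "y \<in> panel s x" "y \<noteq> x" and z: "z \<in> panel s x" "z \<noteq> x"
  obtains f where "f \<in> carrier (Aut \<Delta>)" "f y = z" "\<And>c. avoids s (wall s x) x c \<Longrightarrow> f c = c"
proof -
  let ?h = wall_colouring
  have h: "colour_system ?h" unfolding colour_system_def using colouring_wall_colouring by blast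
  have hs: "colouring s (?h s)" using h s by (simp add: colour_system_def)
  have less: "?h s y < panel_size s" "?h s z < panel_size s"
    using colour_less[OF hs] panel_chambers x y z by blast+
  \<comment> \<open>The colours of \<open>y\<close> and \<open>z\<close> are exchanged on the wall of \<open>x\<close>.\<close>
  define p where "p = transpose (?h s y) (?h s z)"
  have "bij_betw p {..<panel_size s} {..<panel_size s}"
    unfolding p_def using less by (simp add: bij_betw_transpose_iff)
  define g where "g = ?h(s := \<lambda>c. if c \<in> wall s x then p (?h s c) else ?h s c)"
  have g: "colour_system g"
    unfolding g_def colour_system_def
    using h colouring_recolour[OF hs \<open>bij_betw p _ _\<close>] by (simp add: colour_system_def)
  have gs: "colouring s (g s)" using g s by (simp add: colour_system_def)
  define f where "f = transport ?h x g x"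
  have fx: "f x = x" unfolding f_def by (rule transport_base[OF h g x x])
  note shift = transport_shift[OF h g x x, folded f_def]
  have fix_step: "f d = d" if c: "f c = c" "adjacent \<Delta> t c d" "\<not> (t = s \<and> c \<in> wall s x)" for t c d
  proof -
    have cd: "c \<in> Ch" "d \<in> panel t c" "t \<in> S" using adjacentD[OF c(2)] c(2) by (auto simp: panel_def)
    have col: "colouring t (?h t)" "colouring t (g t)" using h g cd(3) by (simp_all add: colour_system_def)
    obtain k where k: "shift t (?h t) k c = d" using shift_reaches[OF col(1) cd(3,1,2)] by blast
    have "g t c = ?h t c \<and> g t d = ?h t d"
    proof (cases "t = s")
      case True
      then have "c \<notin> wall s x" "d \<in> wall s c" using c(3) panel_subset_wall cd(2) by auto
      then have "d \<notin> wall s x" using wall_mem_cong by blast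
      then show ?thesis using True \<open>c \<notin> wall s x\<close> by (simp add: g_def)
    qed (simp add: g_def)
    then have "shift t (g t) k c = d"
      using shift_panel(2)[OF col(1) cd(3,1), of k] k cd by (intro shift_unique[OF col(2)]) simp_all
    then show ?thesis using shift[OF cd(3,1), of k] k c(1) by simp
  qed
  have "f c = c" if "avoids s (wall s x) x c" for c
    using that unfolding avoids_def
    by (induction rule: rtranclp_induct) (use fx fix_step in blast)+
  moreover have "f y = z"
  proof -
    obtain k where k: "shift s (?h s) k x = y" using shift_reaches[OF hs s x y(1)] by blast
    have inj: "inj_on (?h s) (panel s x)" using hs x by (simp add: colouring_def bij_betw_def)
    have "?h s x \<noteq> ?h s y" "?h s x \<noteq> ?h s z" using inj y z panel_self by (metis inj_onD)+
    then have "g s x = ?h s x" "g s z = ?h s y"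
      using panel_subset_wall[OF z(1)] wall_self by (simp_all add: g_def p_def transpose_def)
    then have "shift s (g s) k x = z"
      using shift_panel(2)[OF hs s x, of k] k z s x by (intro shift_unique[OF gs]) simp_all
    then show ?thesis using shift[OF s x, of k] k fx by simp
  qed
  moreover have "f \<in> carrier (Aut \<Delta>)" unfolding f_def by (rule transport_Aut[OF h g x x])
  ultimately show ?thesis using that by blast
qed

end

section \<open>Walls crossed by a gallery\<close>

context right_angled_building
begin

lemma gallery_Aut:
  assumes "f \<in> carrier (Aut \<Delta>)"
  shows "gallery \<Delta> w c d \<Longrightarrow> gallery \<Delta> w (f c) (f d)"
proof (induction w arbitrary: c)
  case (Cons s w)
  then obtain e where e: "adjacent \<Delta> s c e" "gallery \<Delta> w e d" by auto
  then have "adjacent \<Delta> s (f c) (f e)" using assms adjacentD[OF e(1)] by (simp add: Aut_carrier)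
  then show ?case using Cons.IH e(2) by auto
qed simp

lemma reach_Aut: "f \<in> carrier (Aut \<Delta>) \<Longrightarrow> reach J c d \<Longrightarrow> reach J (f c) (f d)"
  unfolding reach_def using gallery_Aut by blast

lemma inverse_Aut:
  assumes "f \<in> carrier (Aut \<Delta>)"
  shows "inv\<^bsub>Aut \<Delta>\<^esub> f \<in> carrier (Aut \<Delta>)"
proof -
  interpret A: group "Aut \<Delta>" by (rule group_Aut)
  show ?thesis using assms by simp
qed

lemma wall_Aut:
  assumes f: "f \<in> carrier (Aut \<Delta>)" and "a \<in> Ch" "x \<in> Ch"
  shows "f a \<in> wall s (f x) \<longleftrightarrow> a \<in> wall s x"
proof
  assume "f a \<in> wall s (f x)"
  then show "a \<in> wall s x"
    using reach_Aut[OF inverse_Aut[OF f], of _ "f x" "f a"] Aut_inv_apply(1)[OF f] assms(2,3)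
    by (simp add: wall_def)
next
  assume "a \<in> wall s x"
  then show "f a \<in> wall s (f x)" using reach_Aut[OF f] by (simp add: wall_def)
qed

lemma avoids_refl: "avoids s T c c"
  by (simp add: avoids_def)

lemma avoids_trans: "avoids s T c d \<Longrightarrow> avoids s T d e \<Longrightarrow> avoids s T c e"
  unfolding avoids_def by (rule rtranclp_trans)

lemma avoids_step: "adjacent \<Delta> t c d \<Longrightarrow> \<not> (t = s \<and> c \<in> T) \<Longrightarrow> avoids s T c d"
  unfolding avoids_def by blast

lemma avoids_sym:
  assumes "avoids s (wall s x) c d"
  shows "avoids s (wall s x) d c"
  using assms[unfolded avoids_def]
proof (induction rule: rtranclp_induct)
  case base
  show ?case by (rule avoids_refl)
next
  case (step d e)
  then obtain t where t: "adjacent \<Delta> t d e" "\<not> (t = s \<and> d \<in> wall s x)" by blast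
  have "e \<in> wall s x \<longleftrightarrow> d \<in> wall s x" if "t = s"
    using t(1) that by (intro wall_mem_cong panel_subset_wall) (simp add: panel_def)
  then have "avoids s (wall s x) e d" using t by (intro avoids_step[OF adjacent_sym]) auto
  then show ?case using step.IH avoids_trans by blast
qed

lemma avoids_Aut:
  assumes f: "f \<in> carrier (Aut \<Delta>)" and x: "x \<in> Ch" and a: "avoids s (wall s x) c d"
  shows "avoids s (wall s (f x)) (f c) (f d)"
  using a[unfolded avoids_def]
proof (induction rule: rtranclp_induct)
  case base
  show ?case by (rule avoids_refl)
next
  case (step d e)
  then obtain t where t: "adjacent \<Delta> t d e" "\<not> (t = s \<and> d \<in> wall s x)" by blast
  note de = adjacentD[OF t(1)]
  have "adjacent \<Delta> t (f d) (f e)" using f t(1) de by (simp add: Aut_carrier)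
  then have "avoids s (wall s (f x)) (f d) (f e)"
    using t(2) wall_Aut[OF f de(1) x] by (intro avoids_step) auto
  then show ?case using step.IH avoids_trans by blast
qed

text \<open>Only the walls crossed by one fixed gallery can separate its ends.\<close>

lemma avoids_all_but_finitely_many:
  assumes "c \<in> Ch" "d \<in> Ch"
  obtains Z where "finite Z" "\<And>s x. (s, wall s x) \<notin> Z \<Longrightarrow> avoids s (wall s x) c d"
proof -
  obtain w where "gallery \<Delta> w c d" using gallery_connected assms by blast
  then have "\<exists>Z. finite Z \<and> (\<forall>s x. (s, wall s x) \<notin> Z \<longrightarrow> avoids s (wall s x) c d)"
  proof (induction w arbitrary: c)
    case Nil
    then show ?case using avoids_refl by (intro exI[of _ "{}"]) simp
  next
    case (Cons t w)
    then obtain e where e: "adjacent \<Delta> t c e" "gallery \<Delta> w e d" by auto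
    obtain Z where Z: "finite Z" "\<And>s x. (s, wall s x) \<notin> Z \<Longrightarrow> avoids s (wall s x) e d"
      using Cons.IH[OF e(2)] by blast
    have "avoids s (wall s x) c d" if "(s, wall s x) \<notin> insert (t, wall t c) Z" for s x
    proof -
      have "\<not> (t = s \<and> c \<in> wall s x)" using that wall_eq[of c s x] by auto
      then have "avoids s (wall s x) c e" by (rule avoids_step[OF e(1)])
      moreover have "avoids s (wall s x) e d" using Z(2) that by simp
      ultimately show ?thesis by (rule avoids_trans)
    qed
    then show ?case using Z(1) by (intro exI[of _ "insert (t, wall t c) Z"]) simp
  qed
  then show ?thesis using that by blast
qed

lemma avoids_finite_set:
  assumes "c \<in> Ch" "finite F" "F \<subseteq> Ch"
  obtains Z where "finite Z" "\<And>s x d. (s, wall s x) \<notin> Z \<Longrightarrow> d \<in> F \<Longrightarrow> avoids s (wall s x) c d"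
proof -
  have "\<exists>Z. finite Z \<and> (\<forall>s x. (s, wall s x) \<notin> Z \<longrightarrow> avoids s (wall s x) c d)" if "d \<in> F" for d
    using avoids_all_but_finitely_many assms that by (metis subsetD)
  then obtain Z where "\<forall>d \<in> F. finite (Z d) \<and> (\<forall>s x. (s, wall s x) \<notin> Z d \<longrightarrow> avoids s (wall s x) c d)"
    by metis
  then show ?thesis using assms(2) that[of "\<Union>(Z ` F)"] by blast
qed

definition path :: "'w list \<Rightarrow> (nat \<Rightarrow> 'c) \<Rightarrow> bool" where
  "path w x \<longleftrightarrow> (\<forall>k < length w. adjacent \<Delta> (w ! k) (x k) (x (Suc k)))"

lemma gallery_path:
  assumes "gallery \<Delta> w c d"
  obtains x where "path w x" "x 0 = c" "x (length w) = d"
proof -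
  have "\<exists>x. path w x \<and> x 0 = c \<and> x (length w) = d"
    using assms
  proof (induction w arbitrary: c)
    case Nil
    then show ?case by (auto simp: path_def)
  next
    case (Cons s w)
    then obtain e where e: "adjacent \<Delta> s c e" "gallery \<Delta> w e d" by auto
    then obtain x where x: "path w x" "x 0 = e" "x (length w) = d" using Cons.IH by blast
    then have "path (s # w) (case_nat c x)"
      using e(1) by (auto simp: path_def nth_Cons split: nat.split)
    then show ?case using x by (intro exI[of _ "case_nat c x"]) simp
  qed
  then show ?thesis using that by blast
qed

lemma path_segment:
  assumes "path w x"
  shows "\<lbrakk>i \<le> j; j \<le> length w\<rbrakk> \<Longrightarrow> gallery \<Delta> (take (j - i) (drop i w)) (x i) (x j)"
proof (induction j)
  case (Suc j)
  show ?case
  proof (cases "i = Suc j")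
    case False
    then have "gallery \<Delta> (take (j - i) (drop i w)) (x i) (x j)" using Suc by simp
    moreover have "take (Suc j - i) (drop i w) = take (j - i) (drop i w) @ [w ! j]"
      using False Suc.prems by (simp add: Suc_diff_le take_Suc_conv_app_nth)
    moreover have "adjacent \<Delta> (w ! j) (x j) (x (Suc j))" using assms Suc.prems by (simp add: path_def)
    ultimately show ?thesis by (auto simp: gallery_append)
  qed simp
qed simp

lemma path_chambers:
  assumes "path w x" "x 0 \<in> Ch" "k \<le> length w"
  shows "x k \<in> Ch"
  using path_segment[OF assms(1), of 0 k] assms gallery_chambers by blast

text \<open>
  The part of the gallery between two crossings of a wall would have its ends in the wall, hence by
  \<open>irreducible_gallery_support\<close> only \<open>s\<close> and letters commuting with \<open>s\<close>. The first \<open>s\<close> after the first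
  crossing could then be merged with it.
\<close>

lemma irreducible_path_crosses_once:
  assumes p: "path w x" and x0: "x 0 \<in> Ch" and irr: "irreducible_word w"
    and ij: "i < j" "j < length w" and eq: "w ! i = w ! j"
  shows "x j \<notin> wall (w ! j) (x i)"
proof
  assume wall: "x j \<in> wall (w ! j) (x i)"
  define s where "s = w ! j"
  define u where "u = take (j - Suc i) (drop (Suc i) w)"
  have "drop (Suc i) w = u @ drop j w"
    unfolding u_def using ij
    by (metis Suc_leI append_take_drop_id drop_drop le_add_diff_inverse2)
  also have "drop j w = s # drop (Suc j) w" using ij by (simp add: Cons_nth_drop_Suc s_def)
  finally have w: "w = take i w @ s # u @ s # drop (Suc j) w"
    using ij eq by (metis (no_types) less_trans id_take_nth_drop s_def)
  have g: "gallery \<Delta> u (x (Suc i)) (x j)" unfolding u_def using ij by (intro path_segment[OF p]) auto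
  have "irreducible_word u"
    using irreducible_factor[of "take i w @ [s]" u "s # drop (Suc j) w"] irr w by simp
  moreover have "x (Suc i) \<in> wall s (x i)"
    using p[unfolded path_def, rule_format, of i] ij eq
    by (intro panel_subset_wall) (simp add: panel_def s_def)
  then have "x j \<in> wall s (x (Suc i))" using wall wall_eq s_def by blast
  then obtain v where v: "v \<in> lists (insert s {t. commutes s t})" "gallery \<Delta> v (x (Suc i)) (x j)"
    unfolding wall_def reach_def by blast
  ultimately have "set u \<subseteq> set v"
    using irreducible_gallery_support g path_chambers[OF p x0] ij by (metis Suc_leI less_trans)
  then have u: "set u \<subseteq> insert s {t. commutes s t}" using v(1) by auto
  obtain a b where ab: "u @ [s] = a @ s # b" "s \<notin> set a"
    using split_list_first[of s "u @ [s]"] by auto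
  then have "set a \<subseteq> set u" by (cases b rule: rev_cases) auto
  then have "\<forall>t \<in> set a. commutes s t" using u ab(2) by blast
  moreover have "w = take i w @ s # a @ s # (b @ drop (Suc j) w)"
    using w ab(1) by (metis append_Cons append_assoc append_Nil)
  ultimately show False using irr unfolding irreducible_word_def by blast
qed

end

section \<open>Orbits of open subgroups\<close>

context thick_semi_regular_building
begin

text \<open>
  The third chamber \<open>z\<close> of the panel exists by thickness. Both \<open>\<alpha>\<close> and \<open>\<beta>\<close> move a chamber to \<open>z\<close>, the
  first fixing \<open>F\<close> and the second fixing \<open>g F\<close>. So \<open>\<beta>\<close> is a conjugate by \<open>g\<close> of an element that fixes \<open>F\<close>.
\<close>

lemma crossing_element:
  assumes H: "subgroup H (Aut \<Delta>)"
    and F: "F \<subseteq> Ch" and stab: "\<And>f. f \<in> carrier (Aut \<Delta>) \<Longrightarrow> \<forall>x \<in> F. f x = x \<Longrightarrow> f \<in> H"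
    and g: "g \<in> H" and ab: "adjacent \<Delta> s a b"
    and near: "\<And>x. x \<in> F \<Longrightarrow> avoids s (wall s a) a x"
    and far: "\<And>x. x \<in> F \<Longrightarrow> avoids s (wall s b) b (g x)"
  obtains r where "r \<in> H" "r a = b"
proof -
  interpret A: group "Aut \<Delta>" by (rule group_Aut)
  interpret H: subgroup H "Aut \<Delta>" by (rule H)
  note c = adjacentD[OF ab]
  have b: "b \<in> panel s a" "b \<noteq> a" using ab c by (auto simp: panel_def)
  have "card {a, b} < card (panel s a)" using panel_card_ge3[OF c(4,1)] c(3) by simp
  then have "\<not> panel s a \<subseteq> {a, b}" using card_mono[of "{a, b}" "panel s a"] by auto
  then obtain z where z: "z \<in> panel s a" "z \<noteq> a" "z \<noteq> b" by blast
  obtain \<alpha> where \<alpha>: "\<alpha> \<in> carrier (Aut \<Delta>)" "\<alpha> b = z" "\<And>x. avoids s (wall s a) a x \<Longrightarrow> \<alpha> x = x"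
    using wing_automorphism[OF c(4,1) b z(1,2)] by blast
  have "a \<in> panel s b" "z \<in> panel s b" using panel_eq[OF b(1)] panel_self z(1) by simp_all
  then obtain \<beta> where \<beta>: "\<beta> \<in> carrier (Aut \<Delta>)" "\<beta> a = z" "\<And>x. avoids s (wall s b) b x \<Longrightarrow> \<beta> x = x"
    using wing_automorphism[OF c(4,2), of a z] b(2) z(3) by metis
  have \<alpha>H: "\<alpha> \<in> H" using stab \<alpha> near by blast
  have gA: "g \<in> carrier (Aut \<Delta>)" using g by (rule H.mem_carrier)
  let ?k = "inv\<^bsub>Aut \<Delta>\<^esub> g \<otimes>\<^bsub>Aut \<Delta>\<^esub> \<beta> \<otimes>\<^bsub>Aut \<Delta>\<^esub> g"
  have "?k x = x" if x: "x \<in> F" for x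
    using x F \<beta>(1) \<beta>(3)[OF far[OF x]] gA Aut_inv_apply(1)[OF gA, of x]
    by (simp add: Aut_mult_apply Aut_closed subset_iff)
  then have "?k \<in> H" using stab gA \<beta>(1) by simp
  moreover have "g \<otimes>\<^bsub>Aut \<Delta>\<^esub> ?k = \<beta> \<otimes>\<^bsub>Aut \<Delta>\<^esub> g"
    using gA \<beta>(1) by (simp add: A.m_assoc[symmetric])
  then have "\<beta> = g \<otimes>\<^bsub>Aut \<Delta>\<^esub> ?k \<otimes>\<^bsub>Aut \<Delta>\<^esub> inv\<^bsub>Aut \<Delta>\<^esub> g"
    using gA \<beta>(1) by (simp add: A.m_assoc)
  ultimately have \<beta>H: "\<beta> \<in> H" using g H.m_closed H.m_inv_closed by metis
  let ?r = "inv\<^bsub>Aut \<Delta>\<^esub> \<alpha> \<otimes>\<^bsub>Aut \<Delta>\<^esub> \<beta>"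
  have "?r a = b"
    using \<alpha>(1) \<beta>(1,2) c(1) Aut_inv_apply(1)[OF \<alpha>(1) c(2)] \<alpha>(2) by (simp add: Aut_mult_apply)
  then show ?thesis by (rule that[rotated]) (use \<alpha>H \<beta>H in simp)
qed

text \<open>
  Let the minimal gallery have length \<open>m\<close>, and let \<open>r\<close> map its chamber \<open>a\<close> at position \<open>k\<close> to the next chamber \<open>b\<close>. Then
  \<open>r c\<close> is at distance at most \<open>k\<close> from \<open>b\<close>, hence at most \<open>2 k + 1\<close> from \<open>c\<close> and at most \<open>m - 1\<close> from \<open>g c\<close>.
  Symmetrically \<open>r\<inverse> g c\<close> is at distance at most \<open>m - 1\<close> from \<open>c\<close> and at most \<open>2 (m - 1 - k) + 1\<close>
  from \<open>g c\<close>. One of the two is an intermediate point unless \<open>2 k + 1 = m\<close>. The bound on the length makes room for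
  a position \<open>k\<close> other than this one at which the crossed wall separates neither \<open>F\<close> nor \<open>g F\<close>.
\<close>

lemma intermediate_orbit_point:
  assumes H: "subgroup H (Aut \<Delta>)"
    and F: "finite F" "F \<subseteq> Ch" "c \<in> F"
    and stab: "\<And>f. f \<in> carrier (Aut \<Delta>) \<Longrightarrow> \<forall>x \<in> F. f x = x \<Longrightarrow> f \<in> H"
  obtains M where "\<And>g w. \<lbrakk>g \<in> H; gallery \<Delta> w c (g c); length w > M;
      \<And>v. gallery \<Delta> v c (g c) \<Longrightarrow> length w \<le> length v\<rbrakk>
    \<Longrightarrow> \<exists>h \<in> H. \<exists>u v. gallery \<Delta> u c (h c) \<and> length u < length w \<and>
      gallery \<Delta> v (h c) (g c) \<and> length v < length w"
proof -
  interpret A: group "Aut \<Delta>" by (rule group_Aut)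
  interpret H: subgroup H "Aut \<Delta>" by (rule H)
  have c: "c \<in> Ch" using F by blast
  obtain Z where Z: "finite Z" "\<And>s x d. (s, wall s x) \<notin> Z \<Longrightarrow> d \<in> F \<Longrightarrow> avoids s (wall s x) c d"
    using avoids_finite_set[OF c F(1,2)] by blast
  have "\<exists>h \<in> H. \<exists>u v. gallery \<Delta> u c (h c) \<and> length u < length w \<and>
      gallery \<Delta> v (h c) (g c) \<and> length v < length w"
    if g: "g \<in> H" and w: "gallery \<Delta> w c (g c)" and long: "length w > 2 * card Z + 1"
      and min: "\<And>v. gallery \<Delta> v c (g c) \<Longrightarrow> length w \<le> length v" for g w
  proof -
    have gA: "g \<in> carrier (Aut \<Delta>)" using g by (rule H.mem_carrier)
    have irr: "irreducible_word w" using gallery_shorten[OF w] min by (metis leD)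
    obtain x where x: "path w x" "x 0 = c" "x (length w) = g c" using gallery_path[OF w] by blast
    have xC: "x k \<in> Ch" if "k \<le> length w" for k using path_chambers x c that by blast
    define m where "m = length w"
    let ?gi = "inv\<^bsub>Aut \<Delta>\<^esub> g"
    have giA: "?gi \<in> carrier (Aut \<Delta>)" using gA by simp
    \<comment> \<open>The wall crossed at position \<open>k\<close> and its image under the inverse of \<open>g\<close>. The wall separates \<open>g F\<close> if and only if the image separates \<open>F\<close>.\<close>
    define K where "K k = (w ! k, wall (w ! k) (x k))" for k
    define L where "L k = (w ! k, wall (w ! k) (?gi (x k)))" for k
    have once: "\<not> (w ! i = w ! j \<and> wall (w ! i) (x i) = wall (w ! j) (x j))"
      if "i < m" "j < m" "i \<noteq> j" for i j
    proof -
      have "\<not> (w ! i = w ! j \<and> wall (w ! i) (x i) = wall (w ! j) (x j))"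
        if "i < j" "j < m" for i j
        using irreducible_path_crosses_once[OF x(1) _ irr, of i j] x(2) c that wall_self m_def by metis
      then show ?thesis using that by (metis linorder_neqE_nat)
    qed
    have injK: "inj_on K {..<m}"
      unfolding inj_on_def K_def using once by (metis Pair_inject lessThan_iff)
    have injL: "inj_on L {..<m}"
    proof (rule inj_onI)
      fix i j assume ij: "i \<in> {..<m}" "j \<in> {..<m}" "L i = L j"
      then have C: "x i \<in> Ch" "x j \<in> Ch" using xC by (auto simp: m_def)
      have "?gi (x i) \<in> wall (w ! j) (?gi (x j))" "w ! i = w ! j"
        using ij(3) wall_self by (auto simp: L_def)
      then have "x i \<in> wall (w ! j) (x j)" using wall_Aut[OF giA C] by simp
      then have "wall (w ! i) (x i) = wall (w ! j) (x j)"
        using wall_eq \<open>w ! i = w ! j\<close> by simp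
      then show "i = j" using once[of i j] ij \<open>w ! i = w ! j\<close> by auto
    qed
    \<comment> \<open>Distinct positions cross distinct walls, so at most \<open>card Z\<close> positions are lost for \<open>F\<close> and for \<open>g F\<close> each.\<close>
    let ?B = "{k \<in> {..<m}. K k \<in> Z}" and ?C = "{k \<in> {..<m}. L k \<in> Z}"
    have "card ?B \<le> card Z"
      by (rule card_inj_on_le[of K]) (use inj_on_subset[OF injK, of ?B] Z(1) in auto)
    moreover have "card ?C \<le> card Z"
      by (rule card_inj_on_le[of L]) (use inj_on_subset[OF injL, of ?C] Z(1) in auto)
    ultimately have "card (?B \<union> ?C) \<le> 2 * card Z" using card_Un_le[of ?B ?C] by linarith
    \<comment> \<open>The middle position has to be avoided too; for even \<open>m\<close> there is none and one harmless position is lost.\<close>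
    then have "card (insert ((m - 1) div 2) (?B \<union> ?C)) \<le> 2 * card Z + 1"
      by (simp add: card_insert_if)
    then have "\<not> {..<m} \<subseteq> insert ((m - 1) div 2) (?B \<union> ?C)"
      using card_mono[of "insert ((m - 1) div 2) (?B \<union> ?C)" "{..<m}"] long by (auto simp: m_def)
    then obtain k where k: "k < m" "K k \<notin> Z" "L k \<notin> Z" "k \<noteq> (m - 1) div 2" by blast
    define s where "s = w ! k"
    let ?a = "x k" and ?b = "x (Suc k)"
    have ab: "adjacent \<Delta> s ?a ?b" using x(1) k(1) by (simp add: path_def s_def m_def)
    have aC: "?a \<in> Ch" "?b \<in> Ch" using adjacentD ab by blast+
    have wall_ab: "wall s ?b = wall s ?a"
      using ab by (intro wall_eq panel_subset_wall) (simp add: panel_def)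
    have edge: "avoids s (wall s ?a) (x j) (x (Suc j))" if "j < m" "j \<noteq> k" for j
    proof (rule avoids_step)
      show "adjacent \<Delta> (w ! j) (x j) (x (Suc j))" using x(1) that by (simp add: path_def m_def)
      show "\<not> (w ! j = s \<and> x j \<in> wall s ?a)"
        using once[OF that(1) k(1) that(2)] wall_eq s_def by metis
    qed
    have before: "avoids s (wall s ?a) c (x j)" if "j \<le> k" for j
      using that
    proof (induction j)
      case 0
      show ?case using x(2) avoids_refl by simp
    next
      case (Suc j)
      show ?case by (rule avoids_trans[OF Suc.IH edge]) (use Suc.prems k(1) in auto)
    qed
    have after: "avoids s (wall s ?a) ?b (x j)" if "Suc k \<le> j" "j \<le> m" for j
      using that
    proof (induction j rule: dec_induct)
      case base
      show ?case by (rule avoids_refl)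
    next
      case (step j)
      show ?case by (rule avoids_trans[OF step.IH edge]) (use step in auto)
    qed
    have near: "avoids s (wall s ?a) ?a y" if "y \<in> F" for y
      using avoids_trans[OF avoids_sym[OF before[OF order_refl]]] Z(2)[OF _ that] k(2)
      by (simp add: K_def s_def)
    have far: "avoids s (wall s ?b) ?b (g y)" if "y \<in> F" for y
    proof -
      have "avoids s (wall s (?gi ?a)) c y" using Z(2)[OF _ that] k(3) by (simp add: L_def s_def)
      then have "avoids s (wall s (g (?gi ?a))) (g c) (g y)"
        using avoids_Aut[OF gA] Aut_closed[OF giA aC(1)] by blast
      then have "avoids s (wall s ?a) (g c) (g y)" using Aut_inv_apply(2)[OF gA aC(1)] by simp
      moreover have "avoids s (wall s ?a) ?b (g c)" using after[of m] k(1) x(3) by (simp add: m_def)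
      ultimately show ?thesis using avoids_trans wall_ab by metis
    qed
    obtain r where r: "r \<in> H" "r ?a = ?b"
      using crossing_element[OF H F(2) stab g ab near far] by blast
    have rA: "r \<in> carrier (Aut \<Delta>)" using r(1) by (rule H.mem_carrier)
    have u: "gallery \<Delta> (take k w) c ?a"
      using path_segment[OF x(1), of 0 k] k(1) x(2) by (simp add: m_def)
    have v: "gallery \<Delta> (drop (Suc k) w) ?b (g c)"
      using path_segment[OF x(1), of "Suc k" m] k(1) x(3) by (simp add: m_def)
    have ru: "gallery \<Delta> (take k w) (r c) ?b" using gallery_Aut[OF rA u] r(2) by simp
    have lens: "length (take k w) = k" "length (drop (Suc k) w) = m - Suc k" using k(1) by (auto simp: m_def)
    show ?thesis
    proof (cases "2 * k + 1 < m")
      case True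
      have "gallery \<Delta> (take k w @ s # rev (take k w)) c (r c)"
        using u ab gallery_rev[OF ru] by (auto simp: gallery_append)
      moreover have "gallery \<Delta> (take k w @ drop (Suc k) w) (r c) (g c)"
        using ru v by (auto simp: gallery_append)
      moreover have "length (take k w @ s # rev (take k w)) < length w"
        "length (take k w @ drop (Suc k) w) < length w"
        using True lens k(1) by (simp_all add: m_def)
      ultimately show ?thesis using r(1) by blast
    next
      case False
      then have k': "2 * k + 1 > m" using k(1,4) by linarith
      let ?h = "inv\<^bsub>Aut \<Delta>\<^esub> r \<otimes>\<^bsub>Aut \<Delta>\<^esub> g"
      have hH: "?h \<in> H" using r(1) g by simp
      have hc: "?h c = (inv\<^bsub>Aut \<Delta>\<^esub> r) (g c)" using rA gA c by (simp add: Aut_mult_apply)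
      have rv: "gallery \<Delta> (drop (Suc k) w) ?a (?h c)"
        using gallery_Aut[OF inverse_Aut[OF rA] v] Aut_inv_apply(1)[OF rA aC(1)] r(2) hc by simp
      have "gallery \<Delta> (take k w @ drop (Suc k) w) c (?h c)"
        using u rv by (auto simp: gallery_append)
      moreover have "gallery \<Delta> (rev (drop (Suc k) w) @ s # drop (Suc k) w) (?h c) (g c)"
        using gallery_rev[OF rv] ab v by (auto simp: gallery_append)
      moreover have "length (rev (drop (Suc k) w) @ s # drop (Suc k) w) < length w"
        "length (take k w @ drop (Suc k) w) < length w"
        using k' lens k(1) by (simp_all add: m_def)
      ultimately show ?thesis using hH by blast
    qed
  qed
  then show ?thesis using that by blast
qed

definition gallery_within :: "nat \<Rightarrow> 'c \<Rightarrow> 'c \<Rightarrow> bool" where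
  "gallery_within n c d \<longleftrightarrow> (\<exists>w. length w \<le> n \<and> gallery \<Delta> w c d)"

lemma finite_gallery_within: "c \<in> Ch \<Longrightarrow> finite {d. gallery_within n c d}"
proof (induction n arbitrary: c)
  case 0
  have "{d. gallery_within 0 c d} \<subseteq> {c}" by (auto simp: gallery_within_def)
  then show ?case by (rule finite_subset) simp
next
  case (Suc n)
  have "{d. gallery_within (Suc n) c d} \<subseteq> insert c (\<Union>s \<in> S. \<Union>e \<in> panel s c. {d. gallery_within n e d})"
  proof clarify
    fix d assume d: "gallery_within (Suc n) c d" "d \<notin> (\<Union>s \<in> S. \<Union>e \<in> panel s c. {d. gallery_within n e d})"
    then obtain w where w: "length w \<le> Suc n" "gallery \<Delta> w c d" unfolding gallery_within_def by blast
    show "d = c"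
    proof (cases w)
      case (Cons s v)
      then obtain e where e: "adjacent \<Delta> s c e" "gallery \<Delta> v e d" using w by auto
      then have "s \<in> S" "e \<in> panel s c" "gallery_within n e d"
        using w Cons adjacentD[OF e(1)] by (auto simp: panel_def gallery_within_def)
      then show ?thesis using d by blast
    qed (use w in simp)
  qed
  moreover have "finite (insert c (\<Union>s \<in> S. \<Union>e \<in> panel s c. {d. gallery_within n e d}))"
    using finite_generators panel_finite Suc panel_chambers by auto
  ultimately show ?case by (rule finite_subset)
qed

text \<open>
  Elements of the union that move \<open>c\<close> by at most \<open>M\<close> have finitely many restrictions to \<open>F\<close>, by local finiteness, and
  two with the same restriction differ by an element of \<open>H 0\<close>. So one group of the chain contains them
  all, and by induction on the distance between \<open>c\<close> and \<open>g c\<close> it contains the whole union.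
\<close>

lemma noetherian_chain:
  assumes H: "\<And>n. subgroup (H n) (Aut \<Delta>)" "\<And>n. H n \<subseteq> H (Suc n)"
    and F: "finite F" "F \<subseteq> Ch" "c \<in> F"
    and stab: "\<And>f. f \<in> carrier (Aut \<Delta>) \<Longrightarrow> \<forall>x \<in> F. f x = x \<Longrightarrow> f \<in> H 0"
  shows "\<exists>N. \<forall>n \<ge> N. H n = H N"
proof -
  interpret A: group "Aut \<Delta>" by (rule group_Aut)
  have c: "c \<in> Ch" using F by blast
  have mono: "H m \<subseteq> H n" if "m \<le> n" for m n using lift_Suc_mono_le[of H, OF H(2) that] .
  define U where "U = (\<Union>n. H n)"
  have U: "subgroup U (Aut \<Delta>)"
  proof (rule A.subgroupI)
    show "U \<subseteq> carrier (Aut \<Delta>)" unfolding U_def using subgroup.subset[OF H(1)] by blast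
    show "U \<noteq> {}" unfolding U_def using subgroup.one_closed[OF H(1)] by blast
    show "inv\<^bsub>Aut \<Delta>\<^esub> a \<in> U" if "a \<in> U" for a
      using that subgroup.m_inv_closed[OF H(1)] unfolding U_def by blast
    show "a \<otimes>\<^bsub>Aut \<Delta>\<^esub> b \<in> U" if a: "a \<in> U" and b: "b \<in> U" for a b
    proof -
      obtain i j where "a \<in> H i" "b \<in> H j" using a b unfolding U_def by blast
      then have "a \<in> H (max i j)" "b \<in> H (max i j)" using mono by (meson max.cobounded1 max.cobounded2 subsetD)+
      then have "a \<otimes>\<^bsub>Aut \<Delta>\<^esub> b \<in> H (max i j)" by (rule subgroup.m_closed[OF H(1)])
      then show ?thesis unfolding U_def by blast
    qed
  qed
  interpret U: subgroup U "Aut \<Delta>" by (rule U)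
  have fixU: "f \<in> U" if "f \<in> carrier (Aut \<Delta>)" "\<forall>x \<in> F. f x = x" for f
    using stab that unfolding U_def by blast
  obtain M where M: "\<And>g w. \<lbrakk>g \<in> U; gallery \<Delta> w c (g c); length w > M;
      \<And>v. gallery \<Delta> v c (g c) \<Longrightarrow> length w \<le> length v\<rbrakk>
    \<Longrightarrow> \<exists>h \<in> U. \<exists>u v. gallery \<Delta> u c (h c) \<and> length u < length w \<and>
      gallery \<Delta> v (h c) (g c) \<and> length v < length w"
    using intermediate_orbit_point[OF U F fixU] by metis
  define E where "E = {h \<in> U. gallery_within M c (h c)}"
  define \<rho> where "\<rho> h = restrict h F" for h :: "'c \<Rightarrow> 'c"
  have "\<exists>n. gallery_within n c x" if "x \<in> F" for x
  proof -
    have "x \<in> Ch" using that F(2) by blast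
    then obtain w where "gallery \<Delta> w c x" using gallery_connected[OF c] by blast
    then show ?thesis unfolding gallery_within_def by blast
  qed
  then obtain l where l: "\<And>x. x \<in> F \<Longrightarrow> gallery_within (l x) c x" by metis
  have "\<rho> ` E \<subseteq> (\<Pi>\<^sub>E x \<in> F. {d. gallery_within (M + l x) c d})"
  proof clarify
    fix h assume h: "h \<in> E"
    have "gallery_within (M + l x) c (h x)" if x: "x \<in> F" for x
    proof -
      obtain u where "length u \<le> M" "gallery \<Delta> u c (h c)" using h by (auto simp: E_def gallery_within_def)
      moreover obtain v where v: "length v \<le> l x" "gallery \<Delta> v c x" using l[OF x] by (auto simp: gallery_within_def)
      moreover have "h \<in> carrier (Aut \<Delta>)" using h by (auto simp: E_def)
      then have "gallery \<Delta> v (h c) (h x)" using gallery_Aut v(2) by blast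
      ultimately have "length (u @ v) \<le> M + l x" "gallery \<Delta> (u @ v) c (h x)"
        by (auto simp: gallery_append)
      then show ?thesis unfolding gallery_within_def by blast
    qed
    then show "\<rho> h \<in> (\<Pi>\<^sub>E x \<in> F. {d. gallery_within (M + l x) c d})" by (auto simp: \<rho>_def)
  qed
  moreover have "finite (\<Pi>\<^sub>E x \<in> F. {d. gallery_within (M + l x) c d})"
    using F(1) finite_gallery_within[OF c] by (intro finite_PiE) auto
  ultimately have "finite (\<rho> ` E)" by (rule finite_subset)
  then obtain R where R: "R \<subseteq> E" "finite R" "\<rho> ` E = \<rho> ` R"
    using finite_subset_image[of "\<rho> ` E" \<rho> E] by auto
  have "\<exists>N. R \<subseteq> H N"
    using R(2) R(1)
  proof (induction R rule: finite_induct)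
    case (insert e R)
    then obtain N where N: "R \<subseteq> H N" by blast
    obtain i where "e \<in> H i" using insert.prems by (auto simp: E_def U_def)
    then have "insert e R \<subseteq> H (max N i)"
      using N mono[of N "max N i"] mono[of i "max N i"] by auto
    then show ?case by blast
  qed simp
  then obtain N where N: "R \<subseteq> H N" by blast
  interpret N: subgroup "H N" "Aut \<Delta>" by (rule H(1))
  have EN: "E \<subseteq> H N"
  proof
    fix h assume h: "h \<in> E"
    then have "\<rho> h \<in> \<rho> ` R" using R(3) by blast
    then obtain e where e: "e \<in> R" "\<rho> h = \<rho> e" by blast
    have hA: "h \<in> carrier (Aut \<Delta>)" using h by (auto simp: E_def)
    have eN: "e \<in> H N" using e(1) N by blast
    then have eA: "e \<in> carrier (Aut \<Delta>)" by (rule N.mem_carrier)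
    let ?k = "inv\<^bsub>Aut \<Delta>\<^esub> e \<otimes>\<^bsub>Aut \<Delta>\<^esub> h"
    have "?k x = x" if x: "x \<in> F" for x
    proof -
      have "h x = e x" using fun_cong[OF e(2), of x] x by (simp add: \<rho>_def)
      moreover have "x \<in> Ch" using x F(2) by blast
      ultimately show ?thesis using hA eA Aut_inv_apply(1)[OF eA, of x] by (simp add: Aut_mult_apply)
    qed
    then have "?k \<in> H 0" using stab hA eA by simp
    then have "?k \<in> H N" using mono[of 0 N] by blast
    then have "e \<otimes>\<^bsub>Aut \<Delta>\<^esub> ?k \<in> H N" using eN by (rule N.m_closed[rotated])
    then show "h \<in> H N" using hA eA by (simp add: A.m_assoc[symmetric])
  qed
  have generated: "g \<in> H N" if "g \<in> U" "gallery \<Delta> w c (g c)" for g w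
    using that
  proof (induction w arbitrary: g rule: length_induct)
    case (1 w)
    note IH = 1(1)[rule_format]
    show ?case
    proof (cases "length w \<le> M")
      case True
      then have "g \<in> E" using 1(2,3) by (auto simp: E_def gallery_within_def)
      then show ?thesis using EN by blast
    next
      case False
      show ?thesis
      proof (cases "\<exists>v. gallery \<Delta> v c (g c) \<and> length v < length w")
        case True
        then show ?thesis using IH 1(2) by blast
      next
        case False
        then obtain h u v where h: "h \<in> U" "gallery \<Delta> u c (h c)" "length u < length w"
          "gallery \<Delta> v (h c) (g c)" "length v < length w"
          using M[OF 1(2,3)] \<open>\<not> length w \<le> M\<close> by (meson not_less)
        have hN: "h \<in> H N" using IH[OF h(3,1,2)] .
        have A: "h \<in> carrier (Aut \<Delta>)" "g \<in> carrier (Aut \<Delta>)" using h(1) 1(2) by auto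
        let ?k = "inv\<^bsub>Aut \<Delta>\<^esub> h \<otimes>\<^bsub>Aut \<Delta>\<^esub> g"
        have "gallery \<Delta> v c (?k c)"
          using gallery_Aut[OF inverse_Aut[OF A(1)] h(4)] Aut_inv_apply(1)[OF A(1) c] A c
          by (simp add: Aut_mult_apply)
        moreover have "?k \<in> U" using h(1) 1(2) by simp
        ultimately have "?k \<in> H N" using IH[OF h(5)] by blast
        then have "h \<otimes>\<^bsub>Aut \<Delta>\<^esub> ?k \<in> H N" using hN by (rule N.m_closed[rotated])
        then show ?thesis using A by (simp add: A.m_assoc[symmetric])
      qed
    qed
  qed
  have "U \<subseteq> H N"
  proof
    fix g assume g: "g \<in> U"
    then have "g c \<in> Ch" using Aut_closed[OF U.mem_carrier c] by blast
    then obtain w where "gallery \<Delta> w c (g c)" using gallery_connected[OF c] by blast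
    then show "g \<in> H N" by (rule generated[OF g])
  qed
  then have "H n = H N" if "n \<ge> N" for n using mono[OF that] unfolding U_def by blast
  then show ?thesis by blast
qed

lemma noetherian_Aut: "noetherian_group (Aut \<Delta>) (permutation_topology Ch (Aut \<Delta>))"
  unfolding noetherian_group_def
proof (intro conjI allI impI)
  show "topological_group (Aut \<Delta>) (permutation_topology Ch (Aut \<Delta>))" by (rule topological_group_Aut)
  interpret A: group "Aut \<Delta>" by (rule group_Aut)
  fix H :: "nat \<Rightarrow> ('c \<Rightarrow> 'c) set"
  assume "\<forall>n. subgroup (H n) (Aut \<Delta>) \<and> openin (permutation_topology Ch (Aut \<Delta>)) (H n) \<and>
    H n \<subseteq> H (Suc n)"
  then have H: "\<And>n. subgroup (H n) (Aut \<Delta>)" "\<And>n. H n \<subseteq> H (Suc n)"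
    and op: "openin (permutation_topology Ch (Aut \<Delta>)) (H 0)" by blast+
  have "\<one>\<^bsub>Aut \<Delta>\<^esub> \<in> H 0" by (rule subgroup.one_closed[OF H(1)])
  then obtain F where F: "finite F" "F \<subseteq> Ch"
    "\<And>h. h \<in> carrier (Aut \<Delta>) \<Longrightarrow> \<forall>x \<in> F. h x = \<one>\<^bsub>Aut \<Delta>\<^esub> x \<Longrightarrow> h \<in> H 0"
    using op unfolding openin_Aut by metis
  have stab: "f \<in> H 0" if "f \<in> carrier (Aut \<Delta>)" "\<forall>x \<in> F. f x = x" for f
    using F(2) that by (intro F(3)) (auto simp: Aut_one subset_iff)
  show "\<exists>N. \<forall>n \<ge> N. H n = H N"
  \<comment> \<open>Without chambers there is no base point for the orbit argument, but then the group is trivial.\<close>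
  proof (cases "Ch = {}")
    case True
    then have "H n = H 0" for n
      using stab F(2) subgroup.subset[OF H(1), of n] lift_Suc_mono_le[of H, OF H(2), of 0 n] by auto
    then show ?thesis by blast
  next
    case False
    then obtain c where c: "c \<in> Ch" by blast
    show ?thesis
      by (rule noetherian_chain[where H = H and F = "insert c F" and c = c, OF H]) (use F c stab in auto)
  qed
qed

end

theorem proposition5p3:
  fixes W :: "('w, 'm) monoid_scheme" and S :: "'w set"
    and \<Delta> :: "('c, 'w) edge_colored_graph" and \<delta> :: "'c \<Rightarrow> 'c \<Rightarrow> 'w"
  assumes "right_angled_building W S \<Delta> \<delta>"
    and "locally_finite S \<Delta>"
    and "thick S \<Delta>"
    and "semi_regular S \<Delta>"
  shows "noetherian_group (Aut \<Delta>) (permutation_topology (chambers \<Delta>) (Aut \<Delta>))"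
proof -
  interpret thick_semi_regular_building W S \<Delta> \<delta>
    using assms by (simp add: thick_semi_regular_building_def
        thick_semi_regular_building_axioms_def)
  show ?thesis by (rule noetherian_Aut)
qed

end
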